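(* The coordination capacity region $\mathcal{C}_{p_0}$ for empirical coordination in the isolated-node network with source distribution $p_0(x)$ is the set of pairs $(R,p(y,z|x))$ such that $Z$ is independent of $X$ and $R\ge I(X;Y|Z)$ under the joint distribution $p_0(x)p(y,z|x)$; that is, $$\mathcal{C}_{p_0}=\{(R,\,p(z)p(y|x,z)) : R\ge I(X;Y|Z)\}.$$
   Context: Alphabets $\mathcal{X},\mathcal{Y},\mathcal{Z}$ are finite; rates are nonnegative reals measured in bits (logarithms base 2); $\{1,\dots,2^{nR}\}$ denotes the set of integers $k$ with $1\le k\le 2^{nR}$. Isolated-node network: a $(2^{nR},n)$ coordination code consists of an encoding function $i:\mathcal{X}^n\to\{1,\dots,2^{nR}\}$, a decoding function $y^n:\{1,\dots,2^{nR}\}\to\mathcal{Y}^n$, and a deterministic sequence $z^n\in\mathcal{Z}^n$. The actions $X^n$ are i.i.d. according to $p_0(x)$, $Y^n=y^n(i(X^n))$, and $Z^n=z^n$. The joint type is $P_{x^n,y^n,z^n}(x,y,z)=\frac1n\sum_{i=1}^n\mathbf{1}((x_i,y_i,z_i)=(x,y,z))$. Total variation is $\|p-q\|_{TV}=\frac12\sum|p-q|$. The distribution $p_0(x)p(y,z|x)$ is achievable for empirical coordination at rate $R$ if there exists a sequence of $(2^{nR},n)$ coordination codes ($n=1,2,\dots$) such that $\|P_{X^n,Y^n,Z^n}-p_0(x)p(y,z|x)\|_{TV}\to0$ in probability. The coordination capacity region $\mathcal{C}_{p_0}$ is the closure of the set of pairs $(R,p(y,z|x))$ such that $p_0(x)p(y,z|x)$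 is achievable at rate $R$. Conditional distributions given $x$ matter only through the joint distribution $p_0(x)p(y,z|x)$. *)

theory Defs
  imports "HOL-Probability.Probability"
begin

text \<open>Alphabets are types of class \<open>finite\<close>; a block of length \<open>n\<close> is a list of length \<open>n\<close>.\<close>

text \<open>The joint distribution \<open>p\<^sub>0(x) p(y,z|x)\<close>.\<close>

definition joint_pmf :: "'x pmf \<Rightarrow> ('x \<Rightarrow> ('y \<times> 'z) pmf) \<Rightarrow> ('x \<times> 'y \<times> 'z) pmf" where
  "joint_pmf p0 W = bind_pmf p0 (\<lambda>x. map_pmf (\<lambda>(y, z). (x, y, z)) (W x))"

text \<open>The conditional distribution \<open>p(z) p(y|x,z)\<close>.\<close>

definition factored_kernel :: "'z pmf \<Rightarrow> ('x \<Rightarrow> 'z \<Rightarrow> 'y pmf) \<Rightarrow> 'x \<Rightarrow> ('y \<times> 'z) pmf" where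
  "factored_kernel pz V x = bind_pmf pz (\<lambda>z. map_pmf (\<lambda>y. (y, z)) (V x z))"

definition joint_type :: "nat \<Rightarrow> 'x list \<Rightarrow> 'y list \<Rightarrow> 'z list \<Rightarrow> 'x \<times> 'y \<times> 'z \<Rightarrow> real" where
  "joint_type n xs ys zs t = (1 / real n) * (\<Sum>i<n. of_bool ((xs ! i, ys ! i, zs ! i) = t))"

definition tv_dist :: "('a::finite \<Rightarrow> real) \<Rightarrow> ('a \<Rightarrow> real) \<Rightarrow> real" where
  "tv_dist p q = (1 / 2) * (\<Sum>t\<in>UNIV. \<bar>p t - q t\<bar>)"

definition messages :: "real \<Rightarrow> nat \<Rightarrow> nat set" where
  "messages R n = {k. 1 \<le> k \<and> real k \<le> 2 powr (real n * R)}"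

definition blocks :: "nat \<Rightarrow> 'a list set" where
  "blocks n = {xs. length xs = n}"

definition coordination_code ::
  "real \<Rightarrow> nat \<Rightarrow> ('x list \<Rightarrow> nat) \<Rightarrow> (nat \<Rightarrow> 'y list) \<Rightarrow> 'z list \<Rightarrow> bool" where
  "coordination_code R n enc dec zs \<longleftrightarrow>
     enc \<in> blocks n \<rightarrow> messages R n \<and> dec \<in> messages R n \<rightarrow> blocks n \<and> zs \<in> blocks n"

text \<open>
  \<open>replicate_pmf n p0\<close> is the law of an i.i.d. block. Since the total variation distance is a
  function of the block alone, its convergence to 0 in probability is a condition on these laws;
  the blocks for different \<open>n\<close> need not live on one probability space.
\<close>

definition achievable ::
  "'x::finite pmf \<Rightarrow> real \<Rightarrow> ('x \<Rightarrow> ('y::finite \<times> 'z::finite) pmf) \<Rightarrow> bool" where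
  "achievable p0 R W \<longleftrightarrow> 0 \<le> R \<and>
     (\<exists>enc dec zs.
        (\<forall>n\<ge>1. coordination_code R n (enc n) (dec n) (zs n)) \<and>
        (\<forall>\<epsilon>>0.
          (\<lambda>n. measure_pmf.prob (replicate_pmf n p0)
                 {xs. tv_dist (joint_type n xs (dec n (enc n xs)) (zs n)) (pmf (joint_pmf p0 W)) > \<epsilon>})
          \<longlonglongrightarrow> 0))"

text \<open>
  A conditional distribution given \<open>x\<close> is identified with the joint distribution it induces, so that
  kernels differing only where \<open>p0\<close> vanishes are not distinguished. The joint distribution is
  represented by its probability mass function, because the type of real functions on a finite
  alphabet carries the Euclidean topology in which the closure is taken.
\<close>

definition coordination_capacity_region ::
  "'x::finite pmf \<Rightarrow> (real \<times> ('x \<times> 'y::finite \<times> 'z::finite \<Rightarrow> real)) set" where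
  "coordination_capacity_region p0 = closure {(R, pmf (joint_pmf p0 W)) | R W. achievable p0 R W}"

text \<open>
  The library's independence of two random variables requires equal codomains, so independence is
  stated for the event systems generated by \<open>Z\<close> and \<open>X\<close>.
\<close>

definition Z_indep_X :: "('x \<times> 'y \<times> 'z) pmf \<Rightarrow> bool" where
  "Z_indep_X J \<longleftrightarrow>
     prob_space.indep_set (measure_pmf J)
       (range (vimage (\<lambda>(x, y, z). z))) (range (vimage (\<lambda>(x, y, z). x)))"

text \<open>\<open>I(X;Y|Z)\<close> in bits.\<close>

definition cond_mutual_info :: "('x \<times> 'y \<times> 'z) pmf \<Rightarrow> real" where
  "cond_mutual_info J =
     prob_space.conditional_mutual_information (measure_pmf J) 2
       (count_space UNIV) (count_space UNIV) (count_space UNIV)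
       (\<lambda>(x, y, z). x) (\<lambda>(x, y, z). y) (\<lambda>(x, y, z). z)"

end

theory Submission
  imports Defs "HOL-Real_Asymp.Real_Asymp"
begin

text \<open>
  Converse: since \<open>z\<^sup>n\<close> is deterministic, the expected joint type \<open>Q\<close> of a code has \<open>X\<close>
  independent of \<open>Z\<close>. The ratios \<open>w = Q(x,y,z) / (p\<^sub>0(x) Q(y,z))\<close> have mean at most 1 when
  \<open>X\<close> is drawn from \<open>p\<^sub>0\<close> and \<open>(y,z)\<close> is fixed, so a union bound over the codewords gives
  \<open>E (w(X\<^sub>1, Y\<^sub>1, z\<^sub>1) \<dots> w(X\<^sub>n, Y\<^sub>n, z\<^sub>n)) \<le> 2 powr (n R)\<close>, and concavity of the logarithm yields
  \<open>I \<le> R\<close> for \<open>Q\<close>. Pairs satisfying both constraints form a closed set by continuity of \<open>t ln t\<close>.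

  Achievability: with a random \<open>z\<^sup>n\<close> and a codebook drawn from \<open>p(y|z)\<close>, some codeword is jointly
  typical with \<open>X\<^sup>n\<close> as soon as \<open>R > I\<close>. Averaging fixes \<open>z\<^sup>n\<close>, a greedy choice of codewords
  fixes the codebook, and the weak law of large numbers controls atypical triples.
\<close>

text \<open>The converse uses neither a chain rule nor a bound on block entropies. The expected type
  is linear in the joint types, so \<open>n\<close> times \<open>info\<close> of \<open>Q\<close> is
  exactly the expected logarithm of the product of the ratios along the block, however dependent the
  letters of the reproduced block are. The ratios are formed from \<open>Q\<close> itself, which is
  a fixed function once the code is given.

  Both directions work with I(X;Y,Z) instead of I(X;Y|Z): its reference measure involves the known
  source and one marginal only, it splits into entropies that are continuous everywhere, and under
  independence the two quantities agree.

  Convergence in probability is traded for convergence of the mean total variation, which is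
  possible because the distance is at most 1. Means can be averaged over types, codebooks and
  blocks.

  Random coding needs strict slack between rate and information. Points on the boundary are reached
  only through the closure in the definition of the region.\<close>

declare sum_of_bool_eq [simp del] sum_mult_of_bool_eq [simp del] sum_of_bool_mult_eq [simp del]

section \<open>Independent blocks\<close>

lemma finite_blocks [simp]: "finite (blocks n :: 'a::finite list set)"
  using finite_lists_length_eq[of "UNIV :: 'a set" n] by (simp add: blocks_def)

lemma sum_blocks_Suc:
  fixes F :: "'a::finite list \<Rightarrow> 'b::comm_monoid_add"
  shows "(\<Sum>xs\<in>blocks (Suc n). F xs) = (\<Sum>x\<in>UNIV. \<Sum>xs\<in>blocks n. F (x # xs))"
proof -
  have "bij_betw (\<lambda>(x, xs). x # xs) (UNIV \<times> blocks n) (blocks (Suc n) :: 'a list set)"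
    by (rule bij_betw_byWitness[where f' = "\<lambda>xs. (hd xs, tl xs)"])
       (auto simp: blocks_def length_Suc_conv)
  from sum.reindex_bij_betw[OF this, of F] show ?thesis
    by (simp add: sum.cartesian_product case_prod_unfold)
qed

text \<open>Distributivity of products over sums, that is, independence of the positions. The
  factors may vary with the position, so that a fixed codeword and a fixed block of \<open>Z\<close>
  letters can enter as constants.\<close>

lemma sum_blocks_prod:
  fixes h :: "nat \<Rightarrow> 'a::finite \<Rightarrow> 'b::comm_semiring_1"
  shows "(\<Sum>xs\<in>blocks n. \<Prod>i<n. h i (xs ! i)) = (\<Prod>i<n. \<Sum>x\<in>UNIV. h i x)"
proof (induction n arbitrary: h)
  case 0
  have "blocks 0 = {[] :: 'a list}" by (auto simp: blocks_def)
  then show ?case by simp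
next
  case (Suc n)
  show ?case
    using Suc[of "\<lambda>i. h (Suc i)"]
    by (simp add: sum_blocks_Suc prod.lessThan_Suc_shift del: prod.lessThan_Suc flip: sum_distrib_left sum_distrib_right)
qed

lemma pmf_replicate_pmf:
  fixes p :: "'a::finite pmf"
  shows "length xs = n \<Longrightarrow> pmf (replicate_pmf n p) xs = (\<Prod>i<n. pmf p (xs ! i))"
proof (induction n arbitrary: xs)
  case (Suc n)
  then obtain x ys where xs: "xs = x # ys" and l: "length ys = n" by (auto simp: length_Suc_conv)
  have "replicate_pmf (Suc n) p = map_pmf (\<lambda>(x, xs). x # xs) (pair_pmf p (replicate_pmf n p))"
    by (simp add: pair_pmf_def map_bind_pmf)
  moreover have "pmf \<dots> xs = pmf (pair_pmf p (replicate_pmf n p)) (x, ys)"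
    using pmf_map_inj'[of "\<lambda>(x, xs). x # xs" "pair_pmf p (replicate_pmf n p)" "(x, ys)"]
    by (auto simp: xs inj_on_def)
  ultimately show ?case
    using Suc.IH[OF l] by (simp add: pmf_pair prod.lessThan_Suc_shift xs del: prod.lessThan_Suc replicate_pmf.simps)
qed simp

lemma set_replicate_pmf_subset: "set_pmf (replicate_pmf n p) \<subseteq> blocks n"
  by (auto simp: set_replicate_pmf blocks_def)

lemma sum_pmf_blocks:
  fixes p :: "'a::finite pmf"
  shows "(\<Sum>xs\<in>blocks n. pmf (replicate_pmf n p) xs) = 1"
  by (intro sum_pmf_eq_1 finite_blocks set_replicate_pmf_subset)

lemma expectation_replicate_pmf:
  fixes p :: "'a::finite pmf" and F :: "'a list \<Rightarrow> real"
  shows "measure_pmf.expectation (replicate_pmf n p) F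
       = (\<Sum>xs\<in>blocks n. pmf (replicate_pmf n p) xs * F xs)"
  using set_replicate_pmf_subset by (subst integral_measure_pmf_real[where A = "blocks n"]) (auto simp: mult.commute)

lemma prob_replicate_pmf:
  fixes p :: "'a::finite pmf"
  shows "measure_pmf.prob (replicate_pmf n p) A
       = (\<Sum>xs\<in>blocks n. pmf (replicate_pmf n p) xs * of_bool (xs \<in> A))"
  using expectation_replicate_pmf[of n p "indicator A"] by (simp add: indicator_def)

lemma pmf_replicate_Cons:
  "pmf (replicate_pmf (Suc n) (p :: 'a::finite pmf)) (x # xs) = pmf p x * pmf (replicate_pmf n p) xs"
  if "xs \<in> blocks n"
  using that by (simp add: pmf_replicate_pmf blocks_def prod.lessThan_Suc_shift del: prod.lessThan_Suc replicate_pmf.simps)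

lemma sum_replicate_Suc:
  fixes p :: "'a::finite pmf" and F :: "'a list \<Rightarrow> real"
  shows "(\<Sum>xs\<in>blocks (Suc n). pmf (replicate_pmf (Suc n) p) xs * F xs)
       = (\<Sum>x\<in>UNIV. pmf p x * (\<Sum>xs\<in>blocks n. pmf (replicate_pmf n p) xs * F (x # xs)))"
  unfolding sum_blocks_Suc sum_distrib_left
  by (intro sum.cong refl) (simp add: pmf_replicate_Cons del: replicate_pmf.simps)

lemma sum_pmf_UNIV [simp]: "(\<Sum>x\<in>UNIV. pmf (p :: 'a::finite pmf) x) = 1"
  by (intro sum_pmf_eq_1) auto

section \<open>Moments of sums along an i.i.d. block and the weak law\<close>

lemma sum_replicate_pmf_sum:
  fixes p :: "'a::finite pmf" and g :: "'a \<Rightarrow> real"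
  assumes g: "(\<Sum>x\<in>UNIV. pmf p x * g x) = 0"
  shows "(\<Sum>xs\<in>blocks n. pmf (replicate_pmf n p) xs * (\<Sum>i<n. g (xs ! i))) = 0"
proof (induction n)
  case (Suc n)
  define P where "P = pmf (replicate_pmf n p)"
  define S where "S = (\<lambda>xs. \<Sum>i<n. g (xs ! i))"
  have "(\<Sum>xs\<in>blocks n. P xs * (g x + S xs)) = g x" for x
    using Suc by (simp add: P_def S_def distrib_left sum.distrib sum_pmf_blocks flip: sum_distrib_right)
  then have "(\<Sum>x\<in>UNIV. pmf p x * (\<Sum>xs\<in>blocks n. P xs * (g x + S xs))) = 0" by (simp add: g)
  then show ?case
    unfolding sum_replicate_Suc
    by (simp add: sum.lessThan_Suc_shift P_def S_def del: sum.lessThan_Suc replicate_pmf.simps)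
qed simp

text \<open>Variances add: when the first letter is split off, the cross term is
  \<open>2 * g x\<close> times a mean that vanishes by the preceding lemma.\<close>

lemma sum_replicate_pmf_sum_square:
  fixes p :: "'a::finite pmf" and g :: "'a \<Rightarrow> real"
  assumes g: "(\<Sum>x\<in>UNIV. pmf p x * g x) = 0"
  shows "(\<Sum>xs\<in>blocks n. pmf (replicate_pmf n p) xs * (\<Sum>i<n. g (xs ! i))\<^sup>2)
       = real n * (\<Sum>x\<in>UNIV. pmf p x * (g x)\<^sup>2)"
proof (induction n)
  case (Suc n)
  define P where "P = pmf (replicate_pmf n p)"
  define S where "S = (\<lambda>xs. \<Sum>i<n. g (xs ! i))"
  have "(\<Sum>xs\<in>blocks n. P xs * (g x + S xs)\<^sup>2)
      = (g x)\<^sup>2 * (\<Sum>xs\<in>blocks n. P xs) + 2 * g x * (\<Sum>xs\<in>blocks n. P xs * S xs)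
        + (\<Sum>xs\<in>blocks n. P xs * (S xs)\<^sup>2)" for x
    unfolding sum_distrib_left sum.distrib[symmetric]
    by (intro sum.cong refl) (simp add: power2_eq_square algebra_simps)
  then have *: "(\<Sum>xs\<in>blocks n. P xs * (g x + S xs)\<^sup>2) = (g x)\<^sup>2 + real n * (\<Sum>x\<in>UNIV. pmf p x * (g x)\<^sup>2)" for x
    using Suc sum_replicate_pmf_sum[OF g, of n] by (simp add: P_def S_def sum_pmf_blocks)
  have "(\<Sum>xs\<in>blocks (Suc n). pmf (replicate_pmf (Suc n) p) xs * (\<Sum>i<Suc n. g (xs ! i))\<^sup>2)
     = (\<Sum>x\<in>UNIV. pmf p x * (\<Sum>xs\<in>blocks n. P xs * (g x + S xs)\<^sup>2))"
    unfolding sum_replicate_Suc by (simp add: sum.lessThan_Suc_shift P_def S_def del: sum.lessThan_Suc replicate_pmf.simps)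
  also have "\<dots> = real (Suc n) * (\<Sum>x\<in>UNIV. pmf p x * (g x)\<^sup>2)"
    unfolding * distrib_left sum.distrib sum_distrib_right[symmetric] sum_pmf_UNIV
    by (simp add: algebra_simps)
  finally show ?case .
qed simp

text \<open>Chebyshev's inequality for the centred function \<open>h\<close>, whose block sum has
  second moment \<open>n * v\<close>; the resulting bound is
  \<open>v / (n * \<epsilon>\<^sup>2)\<close>.\<close>

lemma weak_law_replicate_pmf:
  fixes p :: "'a::finite pmf" and g :: "'a \<Rightarrow> real"
  assumes e: "\<epsilon> > 0" and m: "m = (\<Sum>x\<in>UNIV. pmf p x * g x)"
  shows "(\<lambda>n. measure_pmf.prob (replicate_pmf n p) {xs. real n * \<epsilon> < \<bar>(\<Sum>i<n. g (xs ! i)) - real n * m\<bar>})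
    \<longlonglongrightarrow> 0"
proof -
  define h where "h x = g x - m" for x
  define v where "v = (\<Sum>x\<in>UNIV. pmf p x * (h x)\<^sup>2)"
  have h: "(\<Sum>x\<in>UNIV. pmf p x * h x) = 0"
    by (simp add: h_def m right_diff_distrib sum_subtractf flip: sum_distrib_right)
  have bound: "measure_pmf.prob (replicate_pmf n p) {xs. real n * \<epsilon> < \<bar>(\<Sum>i<n. g (xs ! i)) - real n * m\<bar>}
      \<le> v / \<epsilon>\<^sup>2 * inverse (real n)" if n: "n > 0" for n
  proof -
    have ne: "(real n * \<epsilon>)\<^sup>2 > 0" using n e by simp
    have "of_bool (real n * \<epsilon> < \<bar>(\<Sum>i<n. g (xs ! i)) - real n * m\<bar>)
        \<le> (\<Sum>i<n. h (xs ! i))\<^sup>2 / (real n * \<epsilon>)\<^sup>2" for xs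
    proof (cases "real n * \<epsilon> < \<bar>(\<Sum>i<n. g (xs ! i)) - real n * m\<bar>")
      case True
      then have "real n * \<epsilon> < \<bar>\<Sum>i<n. h (xs ! i)\<bar>" by (simp add: h_def sum_subtractf)
      then have "(real n * \<epsilon>)\<^sup>2 \<le> (\<Sum>i<n. h (xs ! i))\<^sup>2"
        using e by (metis abs_le_square_iff abs_of_nonneg less_imp_le mult_nonneg_nonneg of_nat_0_le_iff)
      then show ?thesis using ne True by (simp add: le_divide_eq)
    qed simp
    then have "measure_pmf.prob (replicate_pmf n p) {xs. real n * \<epsilon> < \<bar>(\<Sum>i<n. g (xs ! i)) - real n * m\<bar>}
      \<le> (\<Sum>xs\<in>blocks n. pmf (replicate_pmf n p) xs * ((\<Sum>i<n. h (xs ! i))\<^sup>2 / (real n * \<epsilon>)\<^sup>2))"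
      unfolding prob_replicate_pmf by (intro sum_mono mult_left_mono) auto
    also have "\<dots> = real n * v / (real n * \<epsilon>)\<^sup>2"
      using sum_replicate_pmf_sum_square[OF h, of n] by (simp add: v_def flip: sum_divide_distrib)
    also have "\<dots> = v / \<epsilon>\<^sup>2 * inverse (real n)"
      using n by (simp add: power2_eq_square field_simps)
    finally show ?thesis .
  qed
  have "(\<lambda>n. v / \<epsilon>\<^sup>2 * inverse (real n)) \<longlonglongrightarrow> 0"
    by (rule tendsto_mult_right_zero[OF lim_inverse_n])
  then show ?thesis
    by (rule tendsto_sandwich[OF _ _ tendsto_const, rotated 2])
       (use bound in \<open>auto intro!: eventually_mono[OF eventually_gt_at_top[of 0]]\<close>)
qed

section \<open>The single-letter region\<close>

lemma sum_UNIV_triple: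
  fixes F :: "'x::finite \<times> 'y::finite \<times> 'z::finite \<Rightarrow> 'b::comm_monoid_add"
  shows "(\<Sum>t\<in>UNIV. F t) = (\<Sum>x\<in>UNIV. \<Sum>y\<in>UNIV. \<Sum>z\<in>UNIV. F (x, y, z))"
  by (simp add: sum.cartesian_product' flip: UNIV_Times_UNIV)

text \<open>Marginals are defined for arbitrary real functions rather than for pmfs: closedness
  concerns a set in function space, and expected types are given as functions too.\<close>

definition mass_Z :: "('x::finite \<times> 'y::finite \<times> 'z \<Rightarrow> real) \<Rightarrow> 'z \<Rightarrow> real" where
  "mass_Z f z = (\<Sum>x\<in>UNIV. \<Sum>y\<in>UNIV. f (x, y, z))"

definition mass_YZ :: "('x::finite \<times> 'y \<times> 'z \<Rightarrow> real) \<Rightarrow> 'y \<Rightarrow> 'z \<Rightarrow> real" where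
  "mass_YZ f y z = (\<Sum>x\<in>UNIV. f (x, y, z))"

definition mass_XZ :: "('x \<times> 'y::finite \<times> 'z \<Rightarrow> real) \<Rightarrow> 'x \<Rightarrow> 'z \<Rightarrow> real" where
  "mass_XZ f x z = (\<Sum>y\<in>UNIV. f (x, y, z))"

definition mass_X :: "('x \<times> 'y::finite \<times> 'z::finite \<Rightarrow> real) \<Rightarrow> 'x \<Rightarrow> real" where
  "mass_X f x = (\<Sum>y\<in>UNIV. \<Sum>z\<in>UNIV. f (x, y, z))"

text \<open>With the source \<open>p\<close> fixed, every condition is linear in \<open>f\<close>,
  independence included, and hence closed. Total mass is not listed because the \<open>X\<close>
  marginal determines it.\<close>

definition indep_joint :: "('x \<Rightarrow> real) \<Rightarrow> ('x::finite \<times> 'y::finite \<times> 'z::finite \<Rightarrow> real) \<Rightarrow> bool" where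
  "indep_joint p f \<longleftrightarrow> (\<forall>t. 0 \<le> f t) \<and> (\<forall>x. mass_X f x = p x) \<and>
     (\<forall>x z. mass_XZ f x z = p x * mass_Z f z)"

text \<open>
  \<open>I(X;Y,Z)\<close> in nats, which equals \<open>I(X;Y|Z)\<close> only because \<open>X\<close> and \<open>Z\<close> are independent.
\<close>

definition info :: "('x \<Rightarrow> real) \<Rightarrow> ('x::finite \<times> 'y::finite \<times> 'z::finite \<Rightarrow> real) \<Rightarrow> real" where
  "info p f = (\<Sum>(x, y, z)\<in>UNIV. f (x, y, z) * ln (f (x, y, z) / (p x * mass_YZ f y z)))"

definition rate_region :: "'x::finite pmf \<Rightarrow> (real \<times> ('x \<times> 'y::finite \<times> 'z::finite \<Rightarrow> real)) set" where
  "rate_region p0 = {(R, f). indep_joint (pmf p0) f \<and> info (pmf p0) f \<le> R * ln 2}"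

section \<open>Positivity of marginals, continuity of the information, closedness\<close>

lemma mass_XZ_pos: "(\<forall>t. 0 \<le> f t) \<Longrightarrow> 0 < f (x, y, z) \<Longrightarrow> 0 < mass_XZ f x z"
  unfolding mass_XZ_def by (rule sum_pos2[of _ y]) auto

lemma mass_YZ_pos: "(\<forall>t. 0 \<le> f t) \<Longrightarrow> 0 < f (x, y, z) \<Longrightarrow> 0 < mass_YZ f y z"
  unfolding mass_YZ_def by (rule sum_pos2[of _ x]) auto

lemma mass_X_pos: "(\<forall>t. 0 \<le> f t) \<Longrightarrow> 0 < f (x, y, z) \<Longrightarrow> 0 < mass_X f x"
  unfolding mass_X_def by (rule sum_pos2[of _ y]) (auto intro!: sum_nonneg sum_pos2[of _ z])

lemma mass_Z_eq_sum_YZ: "mass_Z f z = (\<Sum>y\<in>UNIV. mass_YZ f y z)"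
  unfolding mass_Z_def mass_YZ_def by (rule sum.swap)

text \<open>Continuity on the whole line, not only on the nonnegative half, allows composition with
  any continuous coordinate expression without side conditions.\<close>

lemma continuous_on_x_ln_x: "continuous_on UNIV (\<lambda>x::real. x * ln x)"
proof (rule continuous_at_imp_continuous_on, intro ballI)
  fix x :: real
  show "isCont (\<lambda>x. x * ln x) x"
  proof (cases "x = 0")
    case True
    have r: "((\<lambda>x::real. x * ln x) \<longlongrightarrow> 0) (at_right 0)" by real_asymp
    \<comment> \<open>The real \<open>ln\<close> is even by \<open>ln_minus\<close>, so
      \<open>x * ln x\<close> is odd and reflection turns the limit from the right into the one from
      the left.\<close>
    then have "((\<lambda>x::real. - (x * ln x)) \<longlongrightarrow> - 0) (at_right 0)" by (intro tendsto_minus)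
    then have "((\<lambda>x::real. x * ln x) \<longlongrightarrow> 0) (at_left 0)"
      unfolding at_left_minus[of "0::real"] filterlim_filtermap by (simp add: ln_minus)
    with r show ?thesis unfolding True isCont_def by (simp add: filterlim_at_split)
  next
    case False
    then show ?thesis by (auto intro!: continuous_intros)
  qed
qed

text \<open>The form H(X) + H(Y,Z) - H(X,Y,Z) has no quotients, whose continuity is unclear where a
  marginal vanishes. The logarithm splits because positive \<open>f\<close> forces both marginals to
  be positive; where \<open>f\<close> is 0 all terms are 0.\<close>

lemma info_eq_entropies:
  assumes f: "\<forall>t. 0 \<le> f t" and m: "\<forall>x. mass_X f x = p x"
  shows "info p f = (\<Sum>t\<in>UNIV. f t * ln (f t)) - (\<Sum>x\<in>UNIV. p x * ln (p x))
    - (\<Sum>y\<in>UNIV. \<Sum>z\<in>UNIV. mass_YZ f y z * ln (mass_YZ f y z))"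
proof -
  have eq: "f (x, y, z) * ln (f (x, y, z) / (p x * mass_YZ f y z))
     = f (x, y, z) * ln (f (x, y, z)) - f (x, y, z) * ln (p x) - f (x, y, z) * ln (mass_YZ f y z)" for x y z
  proof (cases "f (x, y, z) = 0")
    case False
    then have pos: "0 < f (x, y, z)" using f by (simp add: order_less_le)
    then have "0 < p x" "0 < mass_YZ f y z" using mass_X_pos[OF f pos] mass_YZ_pos[OF f pos] m by auto
    with pos show ?thesis by (simp add: ln_div ln_mult right_diff_distrib distrib_left)
  qed simp
  have 1: "(\<Sum>x\<in>UNIV. \<Sum>y\<in>UNIV. \<Sum>z\<in>UNIV. f (x, y, z) * ln (p x)) = (\<Sum>x\<in>UNIV. p x * ln (p x))"
    using m by (simp add: mass_X_def flip: sum_distrib_right)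
  have "(\<Sum>x\<in>UNIV. \<Sum>y\<in>UNIV. \<Sum>z\<in>UNIV. f (x, y, z) * ln (mass_YZ f y z))
      = (\<Sum>y\<in>UNIV. \<Sum>x\<in>UNIV. \<Sum>z\<in>UNIV. f (x, y, z) * ln (mass_YZ f y z))"
    by (rule sum.swap)
  also have "\<dots> = (\<Sum>y\<in>UNIV. \<Sum>z\<in>UNIV. \<Sum>x\<in>UNIV. f (x, y, z) * ln (mass_YZ f y z))"
    by (intro sum.cong refl sum.swap)
  also have "\<dots> = (\<Sum>y\<in>UNIV. \<Sum>z\<in>UNIV. mass_YZ f y z * ln (mass_YZ f y z))"
    unfolding sum_distrib_right[symmetric] by (simp add: mass_YZ_def)
  finally show ?thesis
    unfolding info_def sum_UNIV_triple by (simp add: eq sum_subtractf 1)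
qed

lemma closed_rate_region: "closed (rate_region p0)"
proof -
  define h :: "real \<times> ('a \<times> 'b \<times> 'c \<Rightarrow> real) \<Rightarrow> real" where
    "h = (\<lambda>w. (\<Sum>t\<in>UNIV. snd w t * ln (snd w t)) - (\<Sum>x\<in>UNIV. pmf p0 x * ln (pmf p0 x))
      - (\<Sum>y\<in>UNIV. \<Sum>z\<in>UNIV. mass_YZ (snd w) y z * ln (mass_YZ (snd w) y z)))"
  have coord: "continuous_on UNIV (\<lambda>w :: real \<times> ('a \<times> 'b \<times> 'c \<Rightarrow> real). snd w t)" for t
    by (rule continuous_on_compose2[OF continuous_on_product_coordinates[of t]
          continuous_on_snd[OF continuous_on_id] subset_UNIV])
  have eta: "continuous_on UNIV (\<lambda>w. g w * ln (g w))"
    if "continuous_on UNIV g" for g :: "real \<times> ('a \<times> 'b \<times> 'c \<Rightarrow> real) \<Rightarrow> real"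
    using continuous_on_compose2[OF continuous_on_x_ln_x that] by simp
  have h: "continuous_on UNIV h"
    unfolding h_def mass_YZ_def by (intro continuous_intros eta coord)
  \<comment> \<open>\<open>h\<close> is known to equal \<open>info\<close> only under the
    constraints on sign and marginal; these are part of the region, so the replacement is
    legitimate.\<close>
  have "rate_region p0 = {w. (\<forall>t. 0 \<le> snd w t) \<and> (\<forall>x. mass_X (snd w) x = pmf p0 x) \<and>
     (\<forall>x z. mass_XZ (snd w) x z = pmf p0 x * mass_Z (snd w) z) \<and> h w \<le> fst w * ln 2}"
    by (auto simp: rate_region_def indep_joint_def info_eq_entropies h_def)
  also have "closed \<dots>"
    unfolding mass_X_def mass_XZ_def mass_Z_def
    by (intro closed_Collect_conj closed_Collect_all closed_Collect_le closed_Collect_eq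
         continuous_intros coord h)
  finally show ?thesis .
qed

section \<open>From kernels and the library's probabilistic notions to mass functions\<close>

lemma sum_mult_of_bool_point:
  fixes f :: "'a::finite \<Rightarrow> 'b::semiring_1"
  shows "(\<Sum>x\<in>UNIV. f x * of_bool (x = a)) = f a"
  by (simp add: sum_mult_of_bool_eq)

lemma sum_of_bool_point_mult:
  fixes f :: "'a::finite \<Rightarrow> 'b::comm_semiring_1"
  shows "(\<Sum>x\<in>UNIV. of_bool (x = a) * f x) = f a"
  using sum_mult_of_bool_point[of f a] by (simp add: mult.commute)

lemma pmf_joint_pmf:
  "pmf (joint_pmf p0 W) (x, y, z) = pmf (p0 :: 'x::finite pmf) x * pmf (W x) (y, z)"
proof -
  have *: "pmf (map_pmf (\<lambda>(y, z). (x', y, z)) (W x')) (x, y, z) = of_bool (x' = x) * pmf (W x) (y, z)" for x'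
  proof (cases "x' = x")
    case True
    then show ?thesis
      using pmf_map_inj'[of "\<lambda>(y, z). (x, y, z)" "W x" "(y, z)"] by (auto simp: inj_on_def)
  next
    case False
    then show ?thesis by (auto simp: pmf_eq_0_set_pmf)
  qed
  show ?thesis
    unfolding joint_pmf_def pmf_bind *
    using sum_mult_of_bool_point[of "\<lambda>a. pmf p0 a * pmf (W x) (y, z)" x]
    by (subst integral_measure_pmf_real[where A = UNIV]) (simp_all add: mult_ac)
qed

lemma pmf_factored_kernel:
  "pmf (factored_kernel pz V x) (y, z) = pmf (pz :: 'z::finite pmf) z * pmf (V x z) y"
proof -
  have *: "pmf (map_pmf (\<lambda>y. (y, z')) (V x z')) (y, z) = of_bool (z' = z) * pmf (V x z) y" for z'
  proof (cases "z' = z")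
    case True
    then show ?thesis
      using pmf_map_inj'[of "\<lambda>y. (y, z)" "V x z" y] by (auto simp: inj_on_def)
  next
    case False
    then show ?thesis by (auto simp: pmf_eq_0_set_pmf)
  qed
  show ?thesis
    unfolding factored_kernel_def pmf_bind *
    using sum_mult_of_bool_point[of "\<lambda>a. pmf pz a * pmf (V x z) y" z]
    by (subst integral_measure_pmf_real[where A = UNIV]) (simp_all add: mult_ac)
qed

lemma prob_finite:
  "measure_pmf.prob (p :: 'a::finite pmf) A = (\<Sum>t\<in>UNIV. pmf p t * of_bool (t \<in> A))"
proof -
  have "measure_pmf.prob p A = sum (pmf p) A" by (rule measure_measure_pmf_finite) simp
  also have "\<dots> = (\<Sum>t\<in>UNIV. pmf p t * of_bool (t \<in> A))"
    by (intro sum.mono_neutral_cong_left) auto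
  finally show ?thesis .
qed

lemma mass_X_joint_pmf:
  fixes p0 :: "'x::finite pmf"
  shows "mass_X (pmf (joint_pmf p0 W)) x = pmf p0 x"
proof -
  have "(\<Sum>y\<in>UNIV. \<Sum>z\<in>UNIV. pmf (W x) (y, z)) = 1"
    using sum_pmf_UNIV[of "W x"] by (simp add: sum.cartesian_product' flip: UNIV_Times_UNIV del: sum_pmf_UNIV)
  then show ?thesis by (simp add: mass_X_def pmf_joint_pmf flip: sum_distrib_left)
qed

lemma prob_XZ:
  fixes J :: "('x::finite \<times> 'y::finite \<times> 'z::finite) pmf"
  shows "measure_pmf.prob J {(x, y, z). x \<in> B \<and> z \<in> A}
    = (\<Sum>x\<in>UNIV. \<Sum>z\<in>UNIV. of_bool (x \<in> B) * of_bool (z \<in> A) * mass_XZ (pmf J) x z)"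
  unfolding prob_finite sum_UNIV_triple mass_XZ_def sum_distrib_left
  by (intro sum.cong refl, subst sum.swap) (auto intro!: sum.cong)

lemma sum_mass_Z:
  fixes f :: "'x::finite \<times> 'y::finite \<times> 'z::finite \<Rightarrow> real"
  shows "(\<Sum>z\<in>UNIV. mass_Z f z) = (\<Sum>t\<in>UNIV. f t)"
  unfolding sum_UNIV_triple mass_Z_def
  by (subst sum.swap, intro sum.cong refl, rule sum.swap)

lemma mass_Z_eq_sum_XZ: "mass_Z f z = (\<Sum>x\<in>UNIV. mass_XZ f x z)"
  by (simp add: mass_Z_def mass_XZ_def)

lemma mass_X_eq_sum_XZ: "mass_X f x = (\<Sum>z\<in>UNIV. mass_XZ f x z)"
  unfolding mass_X_def mass_XZ_def by (rule sum.swap)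

text \<open>Probabilities of rectangles are sums of \<open>mass_XZ\<close> over pairs of letters.
  Singletons give one direction, and summing the product formula over a rectangle gives the
  other.\<close>

lemma Z_indep_X_iff:
  fixes J :: "('x::finite \<times> 'y::finite \<times> 'z::finite) pmf"
  shows "Z_indep_X J \<longleftrightarrow> (\<forall>x z. mass_XZ (pmf J) x z = mass_X (pmf J) x * mass_Z (pmf J) z)"
proof -
  have ZX: "measure_pmf.prob J ((\<lambda>(x, y, z). z) -` A \<inter> (\<lambda>(x, y, z). x) -` B)
      = (\<Sum>x\<in>UNIV. \<Sum>z\<in>UNIV. of_bool (x \<in> B) * of_bool (z \<in> A) * mass_XZ (pmf J) x z)" for A B
    unfolding prob_XZ[symmetric] by (rule arg_cong[where f = "measure_pmf.prob J"]) auto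
  have Z: "measure_pmf.prob J ((\<lambda>(x, y, z). z) -` A) = (\<Sum>z\<in>UNIV. of_bool (z \<in> A) * mass_Z (pmf J) z)" for A
    using ZX[of A UNIV] by (subst (asm) sum.swap) (simp add: mass_Z_eq_sum_XZ sum_distrib_left)
  have X: "measure_pmf.prob J ((\<lambda>(x, y, z). x) -` B) = (\<Sum>x\<in>UNIV. of_bool (x \<in> B) * mass_X (pmf J) x)" for B
    using ZX[of UNIV B] by (simp add: mass_X_eq_sum_XZ sum_distrib_left)
  have "Z_indep_X J \<longleftrightarrow> (\<forall>A B. measure_pmf.prob J ((\<lambda>(x, y, z). z) -` A \<inter> (\<lambda>(x, y, z). x) -` B)
     = measure_pmf.prob J ((\<lambda>(x, y, z). z) -` A) * measure_pmf.prob J ((\<lambda>(x, y, z). x) -` B))"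
    unfolding Z_indep_X_def prob_space.indep_sets2_eq[OF prob_space_measure_pmf] by auto
  also have "\<dots> \<longleftrightarrow> (\<forall>x z. mass_XZ (pmf J) x z = mass_X (pmf J) x * mass_Z (pmf J) z)"
  proof safe
    fix x z
    assume "\<forall>A B. measure_pmf.prob J ((\<lambda>(x, y, z). z) -` A \<inter> (\<lambda>(x, y, z). x) -` B)
     = measure_pmf.prob J ((\<lambda>(x, y, z). z) -` A) * measure_pmf.prob J ((\<lambda>(x, y, z). x) -` B)"
    from this[rule_format, of "{z}" "{x}"]
    show "mass_XZ (pmf J) x z = mass_X (pmf J) x * mass_Z (pmf J) z"
      unfolding ZX X Z
      by (simp only: singleton_iff mult.assoc sum_distrib_left[symmetric] sum_of_bool_point_mult) (rule mult.commute)
  next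
    fix A B
    assume *: "\<forall>x z. mass_XZ (pmf J) x z = mass_X (pmf J) x * mass_Z (pmf J) z"
    show "measure_pmf.prob J ((\<lambda>(x, y, z). z) -` A \<inter> (\<lambda>(x, y, z). x) -` B)
     = measure_pmf.prob J ((\<lambda>(x, y, z). z) -` A) * measure_pmf.prob J ((\<lambda>(x, y, z). x) -` B)"
      unfolding ZX X Z sum_product by (subst sum.swap, intro sum.cong refl) (simp add: *)
  qed
  finally show ?thesis .
qed

lemma cond_mutual_info_eq_sum:
  fixes J :: "('x::finite \<times> 'y::finite \<times> 'z::finite) pmf"
  shows "cond_mutual_info J = (\<Sum>(x, y, z)\<in>UNIV. pmf J (x, y, z) *
     log 2 (pmf J (x, y, z) / (mass_XZ (pmf J) x z * (mass_YZ (pmf J) y z / mass_Z (pmf J) z))))"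
proof -
  interpret information_space "measure_pmf J" 2
    by (simp add: information_space_def information_space_axioms_def measure_pmf.prob_space_axioms)
  let ?X = "\<lambda>(x, y, z). x" and ?Y = "\<lambda>(x, y, z). y" and ?Z = "\<lambda>(x, y, z). z"
  have sf: "simple_function (measure_pmf J) g" for g :: "'x \<times> 'y \<times> 'z \<Rightarrow> 'd"
    by (simp add: simple_function_def)
  note sd = measure_pmf.simple_distributedI[OF sf]
  \<comment> \<open>The sample space is the full product of the alphabets, so each range is
    everything and the library's sums over ranges become sums over \<open>UNIV\<close>.\<close>
  have X: "range ?X = (UNIV :: 'x set)" and Y: "range ?Y = (UNIV :: 'y set)" and Z: "range ?Z = (UNIV :: 'z set)"
    and XYZ: "range (\<lambda>t. (?X t, ?Y t, ?Z t)) = (UNIV :: ('x \<times> 'y \<times> 'z) set)"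
    by (auto simp: image_iff)
  have reidx: "measure_pmf.prob J B = (\<Sum>u\<in>UNIV. pmf J (h u))"
    if "B = range h" "inj h" for B and h :: "'u::finite \<Rightarrow> 'x \<times> 'y \<times> 'z"
    unfolding that(1) by (subst measure_measure_pmf_finite) (simp_all add: sum.reindex[OF that(2)])
  have Zv: "?Z -` {z} = range (\<lambda>(x, y). (x, y, z))" for z by auto
  have YZv: "(\<lambda>t. (?Y t, ?Z t)) -` {(y, z)} = range (\<lambda>x. (x, y, z))" for y z by auto
  have XZv: "(\<lambda>t. (?X t, ?Z t)) -` {(x, z)} = range (\<lambda>y. (x, y, z))" for x z by auto
  have XYZv: "(\<lambda>t. (?X t, ?Y t, ?Z t)) -` {t} = {t}" for t by (cases t) auto
  have 1: "simple_distributed (measure_pmf J) ?Z (mass_Z (pmf J))"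
  proof (rule sd)
    show "mass_Z (pmf J) z = measure_pmf.prob J (?Z -` {z} \<inter> space (measure_pmf J))" for z
      using reidx[OF Zv, of z] by (simp add: inj_on_def mass_Z_def sum.cartesian_product split_def)
  qed (simp add: mass_Z_def sum_nonneg)
  have 2: "simple_distributed (measure_pmf J) (\<lambda>t. (?Y t, ?Z t)) (\<lambda>(y, z). mass_YZ (pmf J) y z)"
    by (rule sd) (auto simp: reidx[OF YZv] inj_on_def mass_YZ_def intro!: sum_nonneg)
  have 3: "simple_distributed (measure_pmf J) (\<lambda>t. (?X t, ?Z t)) (\<lambda>(x, z). mass_XZ (pmf J) x z)"
    by (rule sd) (auto simp: reidx[OF XZv] inj_on_def mass_XZ_def intro!: sum_nonneg)
  have 4: "simple_distributed (measure_pmf J) (\<lambda>t. (?X t, ?Y t, ?Z t)) (pmf J)"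
    by (rule sd) (simp_all only: XYZv space_measure_pmf Int_UNIV_right measure_pmf_single pmf_nonneg)
  show ?thesis
    using conditional_mutual_information_eq[OF 1 2 3 4]
    unfolding cond_mutual_info_def by (simp add: X Y Z XYZ)
qed

text \<open>Independence gives p(x,z) p(y,z) / p(z) = p(x) p(y,z), so the marginal of
  \<open>Z\<close> cancels wherever the triple has positive mass. The factor \<open>ln 2\<close>
  converts bits to nats.\<close>

lemma cond_mutual_info_eq_info:
  fixes J :: "('x::finite \<times> 'y::finite \<times> 'z::finite) pmf"
  assumes J: "indep_joint p (pmf J)"
  shows "cond_mutual_info J * ln 2 = info p (pmf J)"
proof -
  have nn: "\<forall>t. 0 \<le> pmf J t" by simp
  have *: "pmf J (x, y, z) *
     log 2 (pmf J (x, y, z) / (mass_XZ (pmf J) x z * (mass_YZ (pmf J) y z / mass_Z (pmf J) z))) * ln 2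
    = pmf J (x, y, z) * ln (pmf J (x, y, z) / (p x * mass_YZ (pmf J) y z))" for x y z
  proof (cases "pmf J (x, y, z) = 0")
    case False
    then have pos: "0 < pmf J (x, y, z)" by (simp add: order_less_le)
    have "0 < mass_XZ (pmf J) x z" by (rule mass_XZ_pos[OF nn pos])
    then have "mass_Z (pmf J) z \<noteq> 0" using J by (auto simp: indep_joint_def)
    then show ?thesis using J by (simp add: indep_joint_def log_def)
  qed simp
  show ?thesis
    unfolding cond_mutual_info_eq_sum info_def sum_UNIV_triple sum_distrib_right prod.case * ..
qed

lemma indep_joint_joint_pmf_iff:
  "indep_joint (pmf p0) (pmf (joint_pmf p0 W)) \<longleftrightarrow> Z_indep_X (joint_pmf p0 W)"
  by (simp add: indep_joint_def Z_indep_X_iff mass_X_joint_pmf)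

lemma pmf_joint_factored:
  "pmf (joint_pmf p0 (factored_kernel pz V)) (x, y, z)
    = pmf (p0 :: 'x::finite pmf) x * pmf (pz :: 'z::finite pmf) z * pmf (V x z) y"
  by (simp add: pmf_joint_pmf pmf_factored_kernel)

lemma indep_joint_factored:
  fixes p0 :: "'x::finite pmf" and pz :: "'z::finite pmf" and V :: "'x \<Rightarrow> 'z \<Rightarrow> 'y::finite pmf"
  shows "indep_joint (pmf p0) (pmf (joint_pmf p0 (factored_kernel pz V)))"
  unfolding indep_joint_def mass_X_joint_pmf mass_XZ_def mass_Z_def pmf_joint_factored
  by (simp flip: sum_distrib_left sum_distrib_right)

lemma ex_pmf_eq:
  fixes g :: "'a::finite \<Rightarrow> real"
  assumes "\<And>x. 0 \<le> g x" "(\<Sum>x\<in>UNIV. g x) = 1"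
  shows "\<exists>p. pmf p = g"
proof -
  have "(\<integral>\<^sup>+x. ennreal (g x) \<partial>count_space UNIV) = 1"
    using assms by (simp add: nn_integral_count_space_finite sum_ennreal)
  then have "pmf (embed_pmf g) = g" using assms by (intro ext pmf_embed_pmf) auto
  then show ?thesis by blast
qed

text \<open>Disintegration with \<open>Z\<close> first. Independence is what normalises the kernel:
  the sum of \<open>f (x, y, z)\<close> over \<open>y\<close> is \<open>mass_XZ f x z\<close>, which
  equals the denominator \<open>pmf p0 x * mass_Z f z\<close>.\<close>

lemma indep_joint_imp_factored:
  fixes f :: "'x::finite \<times> 'y::finite \<times> 'z::finite \<Rightarrow> real"
  assumes f: "indep_joint (pmf p0) f"
  shows "\<exists>pz V. pmf (joint_pmf p0 (factored_kernel pz V)) = f"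
proof -
  have nn: "\<forall>t. 0 \<le> f t" and X: "\<And>x. mass_X f x = pmf p0 x"
    and XZ: "\<And>x z. mass_XZ f x z = pmf p0 x * mass_Z f z"
    using f by (auto simp: indep_joint_def)
  have "(\<Sum>t\<in>UNIV. f t) = (\<Sum>x\<in>UNIV. mass_X f x)" by (simp add: sum_UNIV_triple mass_X_def)
  then have "(\<Sum>z\<in>UNIV. mass_Z f z) = 1" by (simp add: sum_mass_Z X)
  moreover have "0 \<le> mass_Z f z" for z unfolding mass_Z_def using nn by (intro sum_nonneg) auto
  ultimately obtain pz where pz: "pmf pz = mass_Z f" using ex_pmf_eq by metis
  \<comment> \<open>Where the denominator is 0 any kernel will do: \<open>mass_XZ f x z\<close> is
    then 0, so \<open>f\<close> vanishes on those triples.\<close>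
  have "\<exists>v. pmf p0 x * mass_Z f z \<noteq> 0 \<longrightarrow> pmf v = (\<lambda>y. f (x, y, z) / (pmf p0 x * mass_Z f z))" for x z
  proof (cases "pmf p0 x * mass_Z f z = 0")
    case False
    have "(\<Sum>y\<in>UNIV. f (x, y, z) / (pmf p0 x * mass_Z f z)) = 1"
      using False XZ[of x z] by (simp add: mass_XZ_def flip: sum_divide_distrib)
    moreover have "0 \<le> f (x, y, z) / (pmf p0 x * mass_Z f z)" for y
      using nn by (simp flip: pz)
    ultimately show ?thesis using ex_pmf_eq[of "\<lambda>y. f (x, y, z) / (pmf p0 x * mass_Z f z)"] by auto
  qed auto
  then obtain V where V: "\<And>x z. pmf p0 x * mass_Z f z \<noteq> 0 \<Longrightarrow>
      pmf (V x z) = (\<lambda>y. f (x, y, z) / (pmf p0 x * mass_Z f z))"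
    by metis
  have "pmf (joint_pmf p0 (factored_kernel pz V)) (x, y, z) = f (x, y, z)" for x y z
  proof (cases "pmf p0 x * mass_Z f z = 0")
    case True
    then have "f (x, y, z) = 0" using mass_XZ_pos[OF nn, of x y z] XZ[of x z] nn by (force simp: order_less_le)
    with True show ?thesis by (simp add: pmf_joint_factored pz)
  next
    case False
    then show ?thesis using V[OF False] by (simp add: pmf_joint_factored pz)
  qed
  then show ?thesis by (intro exI[of _ pz] exI[of _ V]) auto
qed

lemma info_le_iff:
  fixes J :: "('x::finite \<times> 'y::finite \<times> 'z::finite) pmf"
  assumes "indep_joint p (pmf J)"
  shows "info p (pmf J) \<le> R * ln 2 \<longleftrightarrow> cond_mutual_info J \<le> R"
  unfolding cond_mutual_info_eq_info[OF assms, symmetric] by simp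

text \<open>A cycle of three inclusions yields both descriptions at once. Factored kernels come
  first in it because a point of \<open>rate_region\<close> is only a function, and the
  disintegration supplies the pmfs.\<close>

lemma rate_region_eq:
  fixes p0 :: "'x::finite pmf"
  shows "(rate_region p0 :: (real \<times> ('x \<times> 'y::finite \<times> 'z::finite \<Rightarrow> real)) set) =
      {(R, pmf (joint_pmf p0 W)) | R W.
         Z_indep_X (joint_pmf p0 W) \<and> R \<ge> cond_mutual_info (joint_pmf p0 W)}" (is "?S = ?I")
    and "(rate_region p0 :: (real \<times> ('x \<times> 'y \<times> 'z \<Rightarrow> real)) set) =
      {(R, pmf (joint_pmf p0 (factored_kernel pz V))) | R pz V.
         R \<ge> cond_mutual_info (joint_pmf p0 (factored_kernel pz V))}" (is "?S = ?F")
proof -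
  have SF: "?S \<subseteq> ?F"
  proof
    fix w :: "real \<times> ('x \<times> 'y \<times> 'z \<Rightarrow> real)"
    assume w: "w \<in> rate_region p0"
    obtain R f where Rf: "w = (R, f)" by (cases w)
    with w have f: "indep_joint (pmf p0) f" and le: "info (pmf p0) f \<le> R * ln 2"
      by (simp_all add: rate_region_def)
    from indep_joint_imp_factored[OF f] obtain pz V
      where fV: "pmf (joint_pmf p0 (factored_kernel pz V)) = f" by blast
    have "R \<ge> cond_mutual_info (joint_pmf p0 (factored_kernel pz V))"
      using f le unfolding fV[symmetric] by (simp add: info_le_iff)
    then show "w \<in> ?F" unfolding Rf fV[symmetric] by blast
  qed
  have FI: "?F \<subseteq> ?I"
    using indep_joint_factored[of p0] unfolding indep_joint_joint_pmf_iff by blast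
  have IS: "?I \<subseteq> ?S"
    by (auto simp: rate_region_def info_le_iff simp flip: indep_joint_joint_pmf_iff)
  show "?S = ?I" using SF FI IS by (meson subset_antisym subset_trans)
  show "?S = ?F" using SF FI IS by (meson subset_antisym subset_trans)
qed

section \<open>Converse\<close>

text \<open>Integration against an empirical distribution is averaging over positions. In the
  converse this turns a sum over letters into the logarithm of a product along the block.\<close>

lemma sum_joint_type_mult:
  fixes h :: "'x::finite \<times> 'y::finite \<times> 'z::finite \<Rightarrow> real"
  shows "(\<Sum>t\<in>UNIV. joint_type n xs ys zs t * h t) = (1 / real n) * (\<Sum>i<n. h (xs ! i, ys ! i, zs ! i))"
proof -
  have "(\<Sum>t\<in>UNIV. joint_type n xs ys zs t * h t)
      = (1 / real n) * (\<Sum>t\<in>UNIV. \<Sum>i<n. of_bool (t = (xs ! i, ys ! i, zs ! i)) * h t)"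
    by (simp add: joint_type_def sum_distrib_left sum_distrib_right mult_ac eq_commute)
  also have "\<dots> = (1 / real n) * (\<Sum>i<n. h (xs ! i, ys ! i, zs ! i))"
    by (subst sum.swap) (simp only: sum_of_bool_point_mult)
  finally show ?thesis .
qed

lemma joint_type_nonneg: "0 \<le> joint_type n xs ys zs t"
  by (simp add: joint_type_def sum_nonneg)

lemma sum_joint_type:
  fixes xs :: "'x::finite list" and ys :: "'y::finite list" and zs :: "'z::finite list"
  assumes "n \<ge> 1"
  shows "(\<Sum>t\<in>UNIV. joint_type n xs ys zs t) = 1"
  using sum_joint_type_mult[of n xs ys zs "\<lambda>_. 1"] assms by simp

lemma tv_dist_nonneg: "0 \<le> tv_dist p q"
  by (simp add: tv_dist_def sum_nonneg)

lemma tv_dist_le_1: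
  assumes "\<And>t. 0 \<le> p t" "\<And>t. 0 \<le> q t" "sum p UNIV = 1" "sum q UNIV = 1"
  shows "tv_dist p q \<le> 1"
proof -
  have "(\<Sum>t\<in>UNIV. \<bar>p t - q t\<bar>) \<le> (\<Sum>t\<in>UNIV. p t + q t)"
    by (intro sum_mono) (use assms(1,2) in \<open>auto simp: abs_le_iff add_increasing add_increasing2\<close>)
  then show ?thesis using assms by (simp add: tv_dist_def sum.distrib)
qed

lemma abs_diff_le_tv_dist: "\<bar>p t - q t\<bar> \<le> 2 * tv_dist p q"
  unfolding tv_dist_def by (simp add: member_le_sum[of t UNIV "\<lambda>t. \<bar>p t - q t\<bar>"])

lemma finite_messages: "finite (messages R n)"
  and card_messages: "card (messages R n) = nat \<lfloor>2 powr (real n * R)\<rfloor>"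
proof -
  have "messages R n = {1..nat \<lfloor>2 powr (real n * R)\<rfloor>}"
    by (auto simp: messages_def le_nat_iff le_floor_iff)
  then show "finite (messages R n)" "card (messages R n) = nat \<lfloor>2 powr (real n * R)\<rfloor>" by auto
qed

text \<open>For \<open>n \<ge> 1\<close> this is the law of the triple of letters at a uniformly
  random position independent of the source block, the usual time-sharing construction without its
  auxiliary variable.\<close>

definition mean_type ::
  "'x::finite pmf \<Rightarrow> nat \<Rightarrow> ('x list \<Rightarrow> nat) \<Rightarrow> (nat \<Rightarrow> 'y list) \<Rightarrow> 'z list \<Rightarrow> 'x \<times> 'y \<times> 'z \<Rightarrow> real" where
  "mean_type p0 n enc dec zs t =
    (\<Sum>xs\<in>blocks n. pmf (replicate_pmf n p0) xs * joint_type n xs (dec (enc xs)) zs t)"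

lemma replicate_pmf_nth:
  fixes p :: "'a::finite pmf"
  assumes "i < n"
  shows "(\<Sum>xs\<in>blocks n. pmf (replicate_pmf n p) xs * of_bool (xs ! i = a)) = pmf p a"
proof -
  define h where "h j x = pmf p x * (if j = i then of_bool (x = a) else 1)" for j x
  have "(\<Sum>xs\<in>blocks n. pmf (replicate_pmf n p) xs * of_bool (xs ! i = a))
      = (\<Sum>xs\<in>blocks n. \<Prod>j<n. h j (xs ! j))"
    using assms by (intro sum.cong refl) (simp add: h_def pmf_replicate_pmf blocks_def prod.distrib)
  also have "\<dots> = (\<Prod>j<n. \<Sum>x\<in>UNIV. h j x)" by (rule sum_blocks_prod)
  also have "\<dots> = (\<Prod>j<n. if j = i then pmf p a else 1)"
    by (intro prod.cong refl) (auto simp: h_def sum_mult_of_bool_point)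
  also have "\<dots> = pmf p a" using assms by simp
  finally show ?thesis .
qed

text \<open>The source letter has law \<open>p0\<close> at every position while
  \<open>zs ! i\<close> is a constant, so the frequency of \<open>z\<close> in \<open>zs\<close>
  factors out of the mean.\<close>

lemma mass_XZ_mean_type:
  fixes dec :: "nat \<Rightarrow> 'y::finite list"
  shows "mass_XZ (mean_type p0 n enc dec zs) x z = pmf p0 x * ((1 / real n) * (\<Sum>i<n. of_bool (zs ! i = z)))"
proof -
  have "(\<Sum>y\<in>UNIV. joint_type n xs ys zs (x, y, z))
     = (1 / real n) * (\<Sum>i<n. of_bool (xs ! i = x) * of_bool (zs ! i = z))" for xs and ys :: "'y list"
  proof -
    have "(\<Sum>y\<in>UNIV. of_bool (a = x \<and> b = y \<and> c = z)) = (of_bool (a = x) * of_bool (c = z) :: real)"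
      for a c and b :: 'y
      using sum_mult_of_bool_point[of "\<lambda>y. of_bool (a = x) * of_bool (c = z) :: real" b]
      by (simp add: of_bool_conj mult_ac eq_commute)
    then show ?thesis
      unfolding joint_type_def sum_distrib_left[symmetric] by (subst sum.swap) simp
  qed
  then have "mass_XZ (mean_type p0 n enc dec zs) x z
    = (\<Sum>xs\<in>blocks n. pmf (replicate_pmf n p0) xs * ((1 / real n) * (\<Sum>i<n. of_bool (xs ! i = x) * of_bool (zs ! i = z))))"
    unfolding mass_XZ_def mean_type_def by (subst sum.swap) (simp flip: sum_distrib_left)
  also have "\<dots> = (1 / real n) * (\<Sum>xs\<in>blocks n. \<Sum>i<n. of_bool (zs ! i = z) * (pmf (replicate_pmf n p0) xs * of_bool (xs ! i = x)))"
    unfolding sum_distrib_left by (intro sum.cong refl) (simp add: mult_ac)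
  also have "\<dots> = (1 / real n) * (\<Sum>i<n. of_bool (zs ! i = z) * pmf p0 x)"
    by (subst sum.swap) (simp add: replicate_pmf_nth flip: sum_distrib_left)
  finally show ?thesis by (simp add: sum_distrib_left mult_ac)
qed

lemma indep_joint_mean_type:
  fixes dec :: "nat \<Rightarrow> 'y::finite list" and zs :: "'z::finite list"
  assumes "n \<ge> 1"
  shows "indep_joint (pmf p0) (mean_type p0 n enc dec zs)"
proof -
  have Z: "mass_Z (mean_type p0 n enc dec zs) z = (1 / real n) * (\<Sum>i<n. of_bool (zs ! i = z))" for z
    unfolding mass_Z_eq_sum_XZ mass_XZ_mean_type sum_distrib_right[symmetric] by simp
  have "(\<Sum>z\<in>UNIV. of_bool (a = z)) = (1 :: real)" for a :: 'z
    using sum_mult_of_bool_point[of "\<lambda>_. 1 :: real" a] by (simp add: eq_commute[of a])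
  then have "(\<Sum>z\<in>UNIV. (1 / real n) * (\<Sum>i<n. of_bool (zs ! i = z))) = 1"
    using assms unfolding sum_distrib_left[symmetric] by (subst sum.swap) simp
  then have X: "mass_X (mean_type p0 n enc dec zs) x = pmf p0 x" for x
    unfolding mass_X_eq_sum_XZ mass_XZ_mean_type sum_distrib_left[symmetric] by simp
  show ?thesis
    unfolding indep_joint_def Z X mass_XZ_mean_type
    by (auto simp: mean_type_def intro!: sum_nonneg mult_nonneg_nonneg joint_type_nonneg)
qed

lemma info_mean_type_le:
  fixes dec :: "nat \<Rightarrow> 'y::finite list" and zs :: "'z::finite list" and p0 :: "'x::finite pmf"
  assumes n: "n \<ge> 1" and enc: "enc \<in> blocks n \<rightarrow> messages R n"
  shows "info (pmf p0) (mean_type p0 n enc dec zs) \<le> R * ln 2"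
proof -
  define Q where "Q = mean_type p0 n enc dec zs"
  define P where "P = pmf (replicate_pmf n p0)"
  define w where "w = (\<lambda>(x, y, z). Q (x, y, z) / (pmf p0 x * mass_YZ Q y z))"
  define T where "T xs m i = (xs ! i, dec m ! i, zs ! i)" for xs :: "'x list" and m i
  define c where "c = 2 powr (real n * R)"
  have c: "c > 0" by (simp add: c_def)
  \<comment> \<open>Together with \<open>ln s \<le> s - 1\<close> at \<open>s = t / c\<close> this
    bounds \<open>ln\<close> by its tangent at \<open>c\<close>, in place of Jensen's inequality. As
    \<open>c\<close> bounds the mean of the product, \<open>mean / c - 1\<close> is at most
    0.\<close>
  have ln_c: "ln t = ln (t / c) + ln c" if "0 < t" for t using that c by (simp add: ln_div)
  have Q: "indep_joint (pmf p0) Q" unfolding Q_def by (rule indep_joint_mean_type[OF n])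
  then have Q0: "\<forall>t. 0 \<le> Q t" and QX: "\<And>x. mass_X Q x = pmf p0 x" by (auto simp: indep_joint_def)
  have YZ0: "0 \<le> mass_YZ Q y z" for y z unfolding mass_YZ_def using Q0 by (intro sum_nonneg) auto
  have w0: "0 \<le> w t" for t unfolding w_def using Q0 YZ0 by (auto split: prod.split)
  have wpos: "0 < w t" if "0 < Q t" for t
    using that mass_X_pos[OF Q0] mass_YZ_pos[OF Q0] unfolding w_def
    by (cases t) (auto simp flip: QX)
  \<comment> \<open>An inequality suffices and avoids a case distinction: the final quotient is 1,
    or 0 if \<open>mass_YZ Q y z\<close> vanishes.\<close>
  have wsum: "(\<Sum>x\<in>UNIV. pmf p0 x * w (x, y, z)) \<le> 1" for y z
  proof -
    have "(\<Sum>x\<in>UNIV. pmf p0 x * w (x, y, z)) \<le> (\<Sum>x\<in>UNIV. Q (x, y, z) / mass_YZ Q y z)"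
      using Q0 YZ0 by (intro sum_mono) (auto simp: w_def)
    also have "\<dots> = mass_YZ Q y z / mass_YZ Q y z"
      by (simp add: mass_YZ_def flip: sum_divide_distrib)
    also have "\<dots> \<le> 1" by simp
    finally show ?thesis .
  qed
  \<comment> \<open>For a fixed message \<open>m\<close> the codeword does not depend on
    \<open>xs\<close>, so the mean factors over positions. With \<open>enc xs\<close> in place of
    \<open>m\<close> it would not.\<close>
  have Prod: "(\<Sum>xs\<in>blocks n. P xs * (\<Prod>i<n. w (T xs m i))) \<le> 1" for m
  proof -
    have "(\<Sum>xs\<in>blocks n. P xs * (\<Prod>i<n. w (T xs m i)))
       = (\<Sum>xs\<in>blocks n. \<Prod>i<n. pmf p0 (xs ! i) * w (xs ! i, dec m ! i, zs ! i))"
      by (intro sum.cong refl) (simp add: P_def T_def pmf_replicate_pmf blocks_def prod.distrib)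
    also have "\<dots> = (\<Prod>i<n. \<Sum>x\<in>UNIV. pmf p0 x * w (x, dec m ! i, zs ! i))"
      by (rule sum_blocks_prod)
    also have "\<dots> \<le> 1" by (intro prod_le_1) (auto intro!: sum_nonneg mult_nonneg_nonneg w0 wsum)
    finally show ?thesis .
  qed
  have union: "(\<Sum>xs\<in>blocks n. P xs * (\<Prod>i<n. w (T xs (enc xs) i))) \<le> c"
  proof -
    have "(\<Prod>i<n. w (T xs (enc xs) i)) \<le> (\<Sum>m\<in>messages R n. \<Prod>i<n. w (T xs m i))"
      if "xs \<in> blocks n" for xs
      using enc that finite_messages w0
      by (intro member_le_sum[where f = "\<lambda>m. \<Prod>i<n. w (T xs m i)"]) (auto simp: T_def intro!: prod_nonneg)
    then have "(\<Sum>xs\<in>blocks n. P xs * (\<Prod>i<n. w (T xs (enc xs) i)))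
       \<le> (\<Sum>xs\<in>blocks n. P xs * (\<Sum>m\<in>messages R n. \<Prod>i<n. w (T xs m i)))"
      by (intro sum_mono mult_left_mono) (auto simp: P_def)
    also have "\<dots> = (\<Sum>m\<in>messages R n. \<Sum>xs\<in>blocks n. P xs * (\<Prod>i<n. w (T xs m i)))"
      unfolding sum_distrib_left by (rule sum.swap)
    also have "\<dots> \<le> (\<Sum>m\<in>messages R n. 1)" by (intro sum_mono Prod)
    also have "\<dots> \<le> c" by (simp add: card_messages c_def)
    finally show ?thesis .
  qed
  have "real n * info (pmf p0) Q = real n * (\<Sum>t\<in>UNIV. Q t * ln (w t))"
    by (simp add: info_def w_def case_prod_unfold)
  also have "(\<Sum>t\<in>UNIV. Q t * ln (w t))
     = (\<Sum>xs\<in>blocks n. P xs * (\<Sum>t\<in>UNIV. joint_type n xs (dec (enc xs)) zs t * ln (w t)))"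
    unfolding Q_def mean_type_def P_def[symmetric] sum_distrib_left sum_distrib_right
    by (subst sum.swap) (simp add: mult_ac)
  also have "real n * \<dots> = (\<Sum>xs\<in>blocks n. P xs * (\<Sum>i<n. ln (w (T xs (enc xs) i))))"
    using n by (simp add: sum_joint_type_mult T_def sum_distrib_left)
  also have "\<dots> \<le> (\<Sum>xs\<in>blocks n. P xs * ((\<Prod>i<n. w (T xs (enc xs) i)) / c - 1 + ln c))"
  proof (rule sum_mono)
    fix xs :: "'x list" assume xs: "xs \<in> blocks n"
    show "P xs * (\<Sum>i<n. ln (w (T xs (enc xs) i))) \<le> P xs * ((\<Prod>i<n. w (T xs (enc xs) i)) / c - 1 + ln c)"
    proof (cases "P xs = 0")
      case False
      then have P: "P xs > 0" by (simp add: P_def order_less_le)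
      \<comment> \<open>A block of positive probability contributes to the expected type at each of
        its own letters. Hence \<open>Q\<close> and the ratios are positive along it, and the
        logarithm of the product splits.\<close>
      have "0 < Q (T xs (enc xs) i)" if i: "i < n" for i
        unfolding Q_def mean_type_def
      proof (rule sum_pos2[OF finite_blocks xs])
        have "0 < joint_type n xs (dec (enc xs)) zs (T xs (enc xs) i)"
          unfolding joint_type_def using n i
          by (intro mult_pos_pos sum_pos2[of _ i]) (auto simp: T_def)
        then show "0 < pmf (replicate_pmf n p0) xs * joint_type n xs (dec (enc xs)) zs (T xs (enc xs) i)"
          using P by (simp add: P_def)
      qed (simp add: joint_type_nonneg)
      then have pos: "0 < w (T xs (enc xs) i)" if "i < n" for i using that wpos by blast
      then have pp: "0 < (\<Prod>i<n. w (T xs (enc xs) i))" by (intro prod_pos) simp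
      have "(\<Sum>i<n. ln (w (T xs (enc xs) i))) = ln (\<Prod>i<n. w (T xs (enc xs) i))"
        by (intro ln_prod[symmetric]) (auto dest!: pos)
      also have "\<dots> = ln ((\<Prod>i<n. w (T xs (enc xs) i)) / c) + ln c"
        by (rule ln_c[OF pp])
      also have "\<dots> \<le> (\<Prod>i<n. w (T xs (enc xs) i)) / c - 1 + ln c"
        using c pp by (intro add_right_mono ln_le_minus_one divide_pos_pos)
      finally show ?thesis using P by (intro mult_left_mono) auto
    qed simp
  qed
  also have "\<dots> = (\<Sum>xs\<in>blocks n. P xs * (\<Prod>i<n. w (T xs (enc xs) i))) / c + (ln c - 1) * (\<Sum>xs\<in>blocks n. P xs)"
    unfolding sum_divide_distrib sum_distrib_left sum.distrib[symmetric]
    by (intro sum.cong refl) (simp add: algebra_simps)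
  also have "\<dots> \<le> 1 + (ln c - 1) * 1"
    using union c by (intro add_mono) (auto simp: P_def sum_pmf_blocks)
  also have "\<dots> = real n * (R * ln 2)" by (simp add: c_def ln_powr)
  finally show ?thesis using n by (simp add: Q_def)
qed

lemma mean_type_in_rate_region:
  assumes "n \<ge> 1" "coordination_code R n enc dec zs"
  shows "(R, mean_type p0 n enc dec zs) \<in> rate_region p0"
  using assms by (simp add: rate_region_def coordination_code_def indep_joint_mean_type info_mean_type_le)

text \<open>The bound by 1 controls the mean on the exceptional event; Markov's inequality gives the
  other direction.\<close>

lemma prob_tendsto_0_iff_mean_tendsto_0:
  fixes p :: "'a::finite pmf" and F :: "nat \<Rightarrow> 'a list \<Rightarrow> real"
  assumes F: "\<And>n xs. 0 \<le> F n xs" "\<And>n xs. n \<ge> 1 \<Longrightarrow> F n xs \<le> 1"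
  shows "(\<forall>\<epsilon>>0. (\<lambda>n. measure_pmf.prob (replicate_pmf n p) {xs. F n xs > \<epsilon>}) \<longlonglongrightarrow> 0)
    \<longleftrightarrow> (\<lambda>n. \<Sum>xs\<in>blocks n. pmf (replicate_pmf n p) xs * F n xs) \<longlonglongrightarrow> 0"
    (is "?P \<longleftrightarrow> ?E \<longlonglongrightarrow> 0")
proof
  assume P: ?P
  show "?E \<longlonglongrightarrow> 0"
  proof (rule LIMSEQ_I)
    fix r :: real assume r: "0 < r"
    have "eventually (\<lambda>n. measure_pmf.prob (replicate_pmf n p) {xs. F n xs > r / 2} < r / 2) sequentially"
      using P[rule_format, of "r / 2"] r by (intro order_tendstoD(2)[of _ 0]) simp_all
    then have "eventually (\<lambda>n. norm (?E n - 0) < r) sequentially"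
      using eventually_ge_at_top[of 1]
    proof eventually_elim
      case (elim n)
      have "?E n \<le> (\<Sum>xs\<in>blocks n. pmf (replicate_pmf n p) xs * (r / 2 + of_bool (F n xs > r / 2)))"
        using F(1) F(2)[OF elim(2)] r
        by (intro sum_mono mult_left_mono) (auto simp: not_less intro: add_increasing)
      also have "\<dots> = r / 2 * (\<Sum>xs\<in>blocks n. pmf (replicate_pmf n p) xs)
          + measure_pmf.prob (replicate_pmf n p) {xs. F n xs > r / 2}"
        by (simp add: prob_replicate_pmf distrib_left sum.distrib sum_distrib_right sum_distrib_left mult_ac)
      also have "\<dots> < r" using elim(1) by (simp add: sum_pmf_blocks)
      finally show ?case using F(1) by (simp add: sum_nonneg)
    qed
    then show "\<exists>no. \<forall>n\<ge>no. norm (?E n - 0) < r" by (simp add: eventually_sequentially)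
  qed
next
  assume E: "?E \<longlonglongrightarrow> 0"
  show ?P
  proof (intro allI impI)
    fix \<epsilon> :: real assume e: "\<epsilon> > 0"
    have le: "measure_pmf.prob (replicate_pmf n p) {xs. F n xs > \<epsilon>} \<le> ?E n / \<epsilon>" for n
      unfolding prob_replicate_pmf sum_divide_distrib
    proof (rule sum_mono)
      fix xs :: "'a list"
      have "of_bool (xs \<in> {xs. F n xs > \<epsilon>}) \<le> F n xs / \<epsilon>"
        using e F(1)[of n xs] by (auto simp: le_divide_eq)
      then have "pmf (replicate_pmf n p) xs * of_bool (xs \<in> {xs. F n xs > \<epsilon>})
          \<le> pmf (replicate_pmf n p) xs * (F n xs / \<epsilon>)"
        by (intro mult_left_mono) auto
      then show "pmf (replicate_pmf n p) xs * of_bool (xs \<in> {xs. F n xs > \<epsilon>})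
          \<le> pmf (replicate_pmf n p) xs * F n xs / \<epsilon>" by simp
    qed
    have lim: "(\<lambda>n. ?E n / \<epsilon>) \<longlonglongrightarrow> 0" using tendsto_divide[OF E tendsto_const[of \<epsilon>]] e by simp
    show "(\<lambda>n. measure_pmf.prob (replicate_pmf n p) {xs. F n xs > \<epsilon>}) \<longlonglongrightarrow> 0"
      by (rule tendsto_sandwich[OF always_eventually always_eventually tendsto_const lim])
         (simp_all add: le)
  qed
qed

definition mean_distortion ::
  "'x::finite pmf \<Rightarrow> ('x \<times> 'y::finite \<times> 'z::finite \<Rightarrow> real) \<Rightarrow> nat \<Rightarrow>
    ('x list \<Rightarrow> nat) \<Rightarrow> (nat \<Rightarrow> 'y list) \<Rightarrow> 'z list \<Rightarrow> real" where
  "mean_distortion p0 f n enc dec zs =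
    (\<Sum>xs\<in>blocks n. pmf (replicate_pmf n p0) xs * tv_dist (joint_type n xs (dec (enc xs)) zs) f)"

lemma mean_distortion_nonneg: "0 \<le> mean_distortion p0 f n enc dec zs"
  by (simp add: mean_distortion_def sum_nonneg tv_dist_nonneg)

lemma achievable_iff:
  "achievable p0 R W \<longleftrightarrow> 0 \<le> R \<and> (\<exists>enc dec zs. (\<forall>n\<ge>1. coordination_code R n (enc n) (dec n) (zs n)) \<and>
     (\<lambda>n. mean_distortion p0 (pmf (joint_pmf p0 W)) n (enc n) (dec n) (zs n)) \<longlonglongrightarrow> 0)"
proof -
  have "tv_dist (joint_type n xs ys zs) (pmf (joint_pmf p0 W)) \<le> 1" if "n \<ge> 1" for n xs ys zs
    by (intro tv_dist_le_1 joint_type_nonneg sum_joint_type that) auto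
  then show ?thesis
    unfolding achievable_def mean_distortion_def
    by (subst prob_tendsto_0_iff_mean_tendsto_0) (auto simp: tv_dist_nonneg)
qed

text \<open>The triangle inequality under the mean. Vanishing mean distortion therefore forces the
  expected types to converge pointwise to the target.\<close>

lemma abs_mean_type_diff_le:
  "\<bar>mean_type p0 n enc dec zs t - f t\<bar> \<le> 2 * mean_distortion p0 f n enc dec zs"
proof -
  define P where "P = pmf (replicate_pmf n p0)"
  have "mean_type p0 n enc dec zs t - f t
     = (\<Sum>xs\<in>blocks n. P xs * (joint_type n xs (dec (enc xs)) zs t - f t))"
    by (simp add: mean_type_def P_def right_diff_distrib sum_subtractf sum_pmf_blocks flip: sum_distrib_right)
  also have "\<bar>\<dots>\<bar> \<le> (\<Sum>xs\<in>blocks n. P xs * (2 * tv_dist (joint_type n xs (dec (enc xs)) zs) f))"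
    by (intro order_trans[OF sum_abs] sum_mono) (auto simp: P_def abs_mult intro!: mult_left_mono abs_diff_le_tv_dist)
  also have "\<dots> = 2 * mean_distortion p0 f n enc dec zs"
    by (simp add: mean_distortion_def P_def sum_distrib_left mult_ac)
  finally show ?thesis .
qed

lemma achievable_imp_rate_region:
  assumes "achievable p0 R W"
  shows "(R, pmf (joint_pmf p0 W)) \<in> rate_region p0"
proof -
  define f where "f = pmf (joint_pmf p0 W)"
  obtain enc dec zs where code: "\<forall>n\<ge>1. coordination_code R n (enc n) (dec n) (zs n)"
    and D: "(\<lambda>n. mean_distortion p0 f n (enc n) (dec n) (zs n)) \<longlonglongrightarrow> 0"
    using assms by (auto simp: achievable_iff f_def)
  \<comment> \<open>Shifted by one, since codes are required only from length 1 on.\<close>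
  define Q where "Q n = mean_type p0 (Suc n) (enc (Suc n)) (dec (Suc n)) (zs (Suc n))" for n
  have "(\<lambda>n. Q n t) \<longlonglongrightarrow> f t" for t
  proof (rule Lim_null_comparison[THEN LIM_zero_cancel])
    show "(\<lambda>n. 2 * mean_distortion p0 f (Suc n) (enc (Suc n)) (dec (Suc n)) (zs (Suc n))) \<longlonglongrightarrow> 0"
      using tendsto_mult_right_zero[OF LIMSEQ_Suc[OF D], of 2] by simp
  qed (simp add: Q_def abs_mean_type_diff_le)
  then have QL: "Q \<longlonglongrightarrow> f"
    by (simp add: limitin_componentwise flip: limitin_canonical_iff euclidean_product_topology)
  have QR: "(R, Q n) \<in> rate_region p0" for n
    unfolding Q_def using code by (intro mean_type_in_rate_region) auto
  have "(R, f) \<in> rate_region p0"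
    by (rule closed_sequentially[OF closed_rate_region QR tendsto_Pair[OF tendsto_const QL]])
  then show ?thesis by (simp add: f_def)
qed

section \<open>Achievability\<close>

lemma exists_le_average:
  fixes u F :: "'b \<Rightarrow> real"
  assumes "finite B" "\<And>y. y \<in> B \<Longrightarrow> 0 \<le> u y" "sum u B = 1"
  shows "\<exists>y\<in>B. F y \<le> (\<Sum>y\<in>B. u y * F y)"
proof (rule ccontr)
  define a where "a = (\<Sum>y\<in>B. u y * F y)"
  assume "\<not> ?thesis"
  then have gt: "\<And>y. y \<in> B \<Longrightarrow> a < F y" by (auto simp: not_le a_def)
  obtain y0 where y0: "y0 \<in> B" "u y0 > 0"
    by (metis assms(2,3) less_eq_real_def sum.neutral zero_neq_one)
  have "(\<Sum>y\<in>B. u y * a) < (\<Sum>y\<in>B. u y * F y)"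
  proof (rule sum_strict_mono_ex1[OF assms(1)])
    show "\<forall>y\<in>B. u y * a \<le> u y * F y" using assms(2) gt by (auto intro!: mult_left_mono intro: less_imp_le)
    show "\<exists>y\<in>B. u y * a < u y * F y" using y0 gt by (intro bexI[of _ y0]) auto
  qed
  then show False by (simp add: assms(3) a_def flip: sum_distrib_right)
qed

text \<open>\<open>M\<close> independent words drawn from \<open>u\<close> leave \<open>x\<close>
  uncovered with probability \<open>(1 - ...) ^ M\<close>, so the right-hand side is the expected
  uncovered mass. Picking the words one by one, each no worse than average, avoids a measure on
  codebooks. The weight \<open>g\<close> is arbitrary because the induction restricts it to what is
  still uncovered.\<close>

lemma greedy_codebook:
  fixes A :: "'a \<Rightarrow> 'b \<Rightarrow> bool" and g :: "'a \<Rightarrow> real" and u :: "'b \<Rightarrow> real"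
  assumes "finite BX" "finite BY" "\<And>y. y \<in> BY \<Longrightarrow> 0 \<le> u y" "(\<Sum>y\<in>BY. u y) = 1"
    and "\<And>x. x \<in> BX \<Longrightarrow> 0 \<le> g x"
  shows "\<exists>ys. length ys = M \<and> set ys \<subseteq> BY \<and>
    (\<Sum>x\<in>BX. g x * of_bool (\<forall>y\<in>set ys. \<not> A x y))
      \<le> (\<Sum>x\<in>BX. g x * (1 - (\<Sum>y\<in>BY. u y * of_bool (A x y))) ^ M)"
  using assms(5)
proof (induction M arbitrary: g)
  case (Suc M)
  define w where "w x = 1 - (\<Sum>y\<in>BY. u y * of_bool (A x y))" for x
  define F where "F y = (\<Sum>x\<in>BX. g x * w x ^ M * of_bool (\<not> A x y))" for y
  have w: "w x = (\<Sum>y\<in>BY. u y * of_bool (\<not> A x y))" for x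
    unfolding w_def assms(4)[symmetric] sum_subtractf[symmetric] by (intro sum.cong) auto
  have "(\<Sum>y\<in>BY. u y * F y) = (\<Sum>x\<in>BX. \<Sum>y\<in>BY. (g x * w x ^ M) * (u y * of_bool (\<not> A x y)))"
    unfolding F_def sum_distrib_left by (subst sum.swap) (simp add: mult_ac)
  also have "\<dots> = (\<Sum>x\<in>BX. g x * w x ^ Suc M)"
    unfolding sum_distrib_left[symmetric] w[symmetric] by (simp add: mult_ac)
  finally have avg: "(\<Sum>y\<in>BY. u y * F y) = (\<Sum>x\<in>BX. g x * w x ^ Suc M)" .
  have "\<exists>y\<in>BY. F y \<le> (\<Sum>x\<in>BX. g x * w x ^ Suc M)"
    using exists_le_average[OF assms(2,3,4), of F] unfolding avg .
  then obtain y where y: "y \<in> BY" "F y \<le> (\<Sum>x\<in>BX. g x * w x ^ Suc M)" by blast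
  obtain ys where ys: "length ys = M" "set ys \<subseteq> BY"
    "(\<Sum>x\<in>BX. (g x * of_bool (\<not> A x y)) * of_bool (\<forall>y\<in>set ys. \<not> A x y))
      \<le> (\<Sum>x\<in>BX. (g x * of_bool (\<not> A x y)) * w x ^ M)"
    using Suc.IH[of "\<lambda>x. g x * of_bool (\<not> A x y)"] Suc.prems by (auto simp: w_def)
  have "(\<Sum>x\<in>BX. g x * of_bool (\<forall>y\<in>set (y # ys). \<not> A x y))
      = (\<Sum>x\<in>BX. (g x * of_bool (\<not> A x y)) * of_bool (\<forall>y\<in>set ys. \<not> A x y))"
    by (intro sum.cong) auto
  also have "\<dots> \<le> F y" using ys(3) by (simp add: F_def mult_ac)
  finally show ?case using y ys by (intro exI[of _ "y # ys"]) (auto simp: w_def)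
qed simp

text \<open>First \<open>1 - u \<le> exp (- u)\<close>, then convexity of \<open>exp\<close> on the
  chord from 0 to \<open>- (M / K)\<close>. The result separates two causes of failure:
  \<open>1 - v\<close> for atypicality and the exponential for a codebook that is too small. It is
  linear in \<open>v\<close>, hence easily averaged.\<close>

lemma one_minus_power_le:
  fixes u v K :: real
  assumes "0 \<le> v" "v \<le> 1" "u \<le> 1" "v \<le> K * u" "K > 0"
  shows "(1 - u) ^ M \<le> 1 - v + exp (- (real M / K))"
proof -
  have "(1 - u) ^ M \<le> exp (- u) ^ M"
    using exp_ge_add_one_self[of "-u"] assms by (intro power_mono) auto
  also have "\<dots> = exp (- (real M * u))" by (simp add: exp_of_nat_mult[symmetric])
  also have "\<dots> \<le> exp (v * (- (real M / K)))"
  proof -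
    have "v / K \<le> u" using assms by (simp add: divide_le_eq mult.commute)
    then have "real M * (v / K) \<le> real M * u" by (intro mult_left_mono) auto
    then show ?thesis by (simp add: mult.commute)
  qed
  also have "\<dots> \<le> (1 - v) * exp 0 + v * exp (- (real M / K))"
    using convex_onD[OF exp_convex, of v 0 "- (real M / K)"] assms by simp
  also have "\<dots> \<le> 1 - v + exp (- (real M / K))"
    using assms by (auto intro!: mult_left_le_one_le)
  finally show ?thesis .
qed

text \<open>Codewords come from \<open>U z\<close>, whereas a good triple has \<open>y\<close>
  distributed by \<open>V x z\<close>. On \<open>A\<close> this change of measure costs at most the
  factor \<open>K\<close>, so the exponential term is small once \<open>M\<close> is large compared
  with \<open>K\<close>.\<close>

lemma one_shot_covering:
  fixes A :: "'a \<Rightarrow> 'b \<Rightarrow> 'c \<Rightarrow> bool"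
    and \<mu> :: "'a \<Rightarrow> real" and \<sigma> :: "'c \<Rightarrow> real" and V :: "'a \<Rightarrow> 'c \<Rightarrow> 'b \<Rightarrow> real" and U :: "'c \<Rightarrow> 'b \<Rightarrow> real"
  assumes fin: "finite BX" "finite BY" "finite BZ"
    and \<mu>: "\<And>x. 0 \<le> \<mu> x" "sum \<mu> BX = 1"
    and \<sigma>: "\<And>z. 0 \<le> \<sigma> z" "sum \<sigma> BZ = 1"
    and V: "\<And>x y z. 0 \<le> V x z y" "\<And>x z. sum (V x z) BY = 1"
    and U: "\<And>y z. 0 \<le> U z y" "\<And>z. sum (U z) BY = 1"
    and K: "K > 0"
    and A: "\<And>x y z. x \<in> BX \<Longrightarrow> y \<in> BY \<Longrightarrow> z \<in> BZ \<Longrightarrow> A x y z \<Longrightarrow> V x z y \<le> K * U z y"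
  shows "\<exists>z\<in>BZ. \<exists>ys. length ys = M \<and> set ys \<subseteq> BY \<and>
    (\<Sum>x\<in>BX. \<mu> x * of_bool (\<forall>y\<in>set ys. \<not> A x y z))
      \<le> 1 - (\<Sum>x\<in>BX. \<Sum>y\<in>BY. \<Sum>z\<in>BZ. \<mu> x * \<sigma> z * V x z y * of_bool (A x y z)) + exp (- (real M / K))"
proof -
  define E where "E = exp (- (real M / K))"
  define v where "v x z = (\<Sum>y\<in>BY. V x z y * of_bool (A x y z))" for x z
  define f where "f z = (\<Sum>x\<in>BX. \<mu> x * (1 - v x z + E))" for z
  have fail: "\<exists>ys. length ys = M \<and> set ys \<subseteq> BY \<and> (\<Sum>x\<in>BX. \<mu> x * of_bool (\<forall>y\<in>set ys. \<not> A x y z)) \<le> f z"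
    if z: "z \<in> BZ" for z
  proof -
    obtain ys where ys: "length ys = M" "set ys \<subseteq> BY"
      "(\<Sum>x\<in>BX. \<mu> x * of_bool (\<forall>y\<in>set ys. \<not> A x y z))
       \<le> (\<Sum>x\<in>BX. \<mu> x * (1 - (\<Sum>y\<in>BY. U z y * of_bool (A x y z))) ^ M)"
      using greedy_codebook[OF fin(1,2), of "U z" \<mu> M "\<lambda>x y. A x y z"] U \<mu> by auto
    have "(1 - (\<Sum>y\<in>BY. U z y * of_bool (A x y z))) ^ M \<le> 1 - v x z + E" if x: "x \<in> BX" for x
      unfolding E_def
    proof (rule one_minus_power_le[OF _ _ _ _ K])
      show "0 \<le> v x z" unfolding v_def by (intro sum_nonneg) (auto simp: V)
      have "v x z \<le> sum (V x z) BY" unfolding v_def by (intro sum_mono) (auto simp: V)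
      then show "v x z \<le> 1" by (simp add: V)
      have "(\<Sum>y\<in>BY. U z y * of_bool (A x y z)) \<le> sum (U z) BY" by (intro sum_mono) (auto simp: U)
      then show "(\<Sum>y\<in>BY. U z y * of_bool (A x y z)) \<le> 1" by (simp add: U)
      show "v x z \<le> K * (\<Sum>y\<in>BY. U z y * of_bool (A x y z))"
        unfolding v_def sum_distrib_left by (intro sum_mono) (auto intro: A[OF x _ z])
    qed
    then have "(\<Sum>x\<in>BX. \<mu> x * (1 - (\<Sum>y\<in>BY. U z y * of_bool (A x y z))) ^ M) \<le> f z"
      unfolding f_def by (intro sum_mono mult_left_mono) (auto simp: \<mu>)
    with ys show ?thesis by (intro exI[of _ ys]) auto
  qed
  define T where "T = (\<Sum>x\<in>BX. \<Sum>y\<in>BY. \<Sum>z\<in>BZ. \<mu> x * \<sigma> z * V x z y * of_bool (A x y z))"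
  have T: "T = (\<Sum>z\<in>BZ. \<sigma> z * (\<Sum>x\<in>BX. \<mu> x * v x z))"
  proof -
    have "T = (\<Sum>x\<in>BX. \<Sum>z\<in>BZ. \<Sum>y\<in>BY. \<mu> x * \<sigma> z * V x z y * of_bool (A x y z))"
      unfolding T_def by (intro sum.cong refl sum.swap)
    also have "\<dots> = (\<Sum>z\<in>BZ. \<sigma> z * (\<Sum>x\<in>BX. \<mu> x * v x z))"
      unfolding v_def sum_distrib_left by (subst sum.swap) (simp add: mult_ac)
    finally show ?thesis .
  qed
  have f: "f z = 1 + E - (\<Sum>x\<in>BX. \<mu> x * v x z)" for z
    unfolding f_def distrib_left right_diff_distrib sum.distrib sum_subtractf sum_distrib_right[symmetric] \<mu>(2)
    by (simp add: \<mu>)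
  have avg: "(\<Sum>z\<in>BZ. \<sigma> z * f z) = 1 - T + E"
    unfolding f T distrib_left right_diff_distrib sum.distrib sum_subtractf sum_distrib_right[symmetric] \<sigma>(2)
    by (simp add: \<sigma>)
  have "\<exists>z\<in>BZ. f z \<le> 1 - T + E"
    using exists_le_average[OF fin(3) \<sigma>, of f] unfolding avg .
  then obtain z where "z \<in> BZ" "f z \<le> 1 - T + E" by blast
  moreover from this(1) fail obtain ys where "length ys = M" "set ys \<subseteq> BY"
    "(\<Sum>x\<in>BX. \<mu> x * of_bool (\<forall>y\<in>set ys. \<not> A x y z)) \<le> f z" by blast
  ultimately show ?thesis
    unfolding T_def E_def by (intro bexI[of _ z] exI[of _ ys]) auto
qed

text \<open>Gibbs' inequality, termwise from \<open>ln t \<le> t - 1\<close>. The linear terms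
  cancel in the sum because \<open>f\<close> and \<open>p x * mass_YZ f y z\<close> both have total
  mass 1.\<close>

lemma info_nonneg:
  assumes f: "indep_joint p f" and p: "sum p UNIV = 1"
  shows "0 \<le> info p f"
proof -
  have nn: "\<forall>t. 0 \<le> f t" and X: "\<And>x. mass_X f x = p x" using f by (auto simp: indep_joint_def)
  have le: "f (x, y, z) - p x * mass_YZ f y z \<le> f (x, y, z) * ln (f (x, y, z) / (p x * mass_YZ f y z))" for x y z
  proof (cases "f (x, y, z) = 0")
    case True
    have "0 \<le> p x" using nn unfolding X[symmetric] mass_X_def by (intro sum_nonneg) auto
    moreover have "0 \<le> mass_YZ f y z" using nn unfolding mass_YZ_def by (intro sum_nonneg) auto
    ultimately show ?thesis using True by simp
  next
    case False
    then have pos: "0 < f (x, y, z)" using nn by (simp add: order_less_le)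
    define q where "q = p x * mass_YZ f y z"
    have q: "0 < q" using mass_X_pos[OF nn pos] mass_YZ_pos[OF nn pos] by (simp add: q_def X)
    have "ln (q / f (x, y, z)) \<le> q / f (x, y, z) - 1" using q pos by (intro ln_le_minus_one) simp
    then have "f (x, y, z) * (1 - q / f (x, y, z)) \<le> f (x, y, z) * ln (f (x, y, z) / q)"
      using q pos by (intro mult_left_mono) (simp_all add: ln_div)
    then show ?thesis using pos by (simp add: q_def right_diff_distrib)
  qed
  have f1: "(\<Sum>x\<in>UNIV. \<Sum>y\<in>UNIV. \<Sum>z\<in>UNIV. f (x, y, z)) = 1"
    using p by (simp add: X flip: mass_X_def)
  have "(\<Sum>y\<in>UNIV. \<Sum>z\<in>UNIV. mass_YZ f y z) = (\<Sum>t\<in>UNIV. f t)"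
    by (subst sum.swap) (simp add: sum_mass_Z flip: mass_Z_eq_sum_YZ)
  also have "\<dots> = 1" unfolding sum_UNIV_triple by (rule f1)
  finally have q1: "(\<Sum>x\<in>UNIV. \<Sum>y\<in>UNIV. \<Sum>z\<in>UNIV. p x * mass_YZ f y z) = 1"
    using p by (simp flip: sum_distrib_left)
  have "0 = (\<Sum>x\<in>UNIV. \<Sum>y\<in>UNIV. \<Sum>z\<in>UNIV. f (x, y, z) - p x * mass_YZ f y z)"
    by (simp add: sum_subtractf f1 q1)
  also have "\<dots> \<le> info p f" unfolding info_def sum_UNIV_triple prod.case by (intro sum_mono le)
  finally show ?thesis .
qed

text \<open>Instead of letting the tolerance shrink with \<open>n\<close> at a controlled speed,
  choose for each \<open>n\<close> a candidate within \<open>1 / (n + 1)\<close> of the infimum; it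
  is then almost as good as the candidate for any fixed tolerance.\<close>

lemma diagonal_choice:
  fixes d :: "nat \<Rightarrow> 'c \<Rightarrow> real"
  assumes ex: "\<And>n. \<exists>c. C n c" and nn: "\<And>n c. 0 \<le> d n c"
    and small: "\<And>e. e > 0 \<Longrightarrow> eventually (\<lambda>n. \<exists>c. C n c \<and> d n c \<le> e) sequentially"
  shows "\<exists>c. (\<forall>n. C n (c n)) \<and> (\<lambda>n. d n (c n)) \<longlonglongrightarrow> 0"
proof -
  define I where "I n = Inf (d n ` Collect (C n))" for n
  have bdd: "bdd_below (d n ` Collect (C n))" for n using nn by (auto intro!: bdd_belowI[of _ 0])
  have "\<exists>c. C n c \<and> d n c < I n + inverse (real (Suc n))" for n
    using cInf_lessD[of "d n ` Collect (C n)" "I n + inverse (real (Suc n))"] ex[of n] by (auto simp: I_def)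
  then obtain c where c: "\<And>n. C n (c n)" "\<And>n. d n (c n) < I n + inverse (real (Suc n))" by metis
  have "(\<lambda>n. d n (c n)) \<longlonglongrightarrow> 0"
  proof (rule LIMSEQ_I)
    fix r :: real assume r: "0 < r"
    have "eventually (\<lambda>n. inverse (real (Suc n)) < r / 2) sequentially"
      using LIMSEQ_inverse_real_of_nat r by (intro order_tendstoD(2)[of _ 0]) simp_all
    moreover have "eventually (\<lambda>n. \<exists>c. C n c \<and> d n c \<le> r / 2) sequentially"
      by (rule small) (use r in simp)
    ultimately have "eventually (\<lambda>n. norm (d n (c n) - 0) < r) sequentially"
    proof eventually_elim
      case (elim n)
      then obtain c' where c': "C n c'" "d n c' \<le> r / 2" by blast
      have "I n \<le> d n c'" unfolding I_def using c'(1) bdd by (intro cInf_lower) auto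
      then show ?case using c(2)[of n] c'(2) elim(1) nn[of n "c n"] by simp
    qed
    then show "\<exists>no. \<forall>n\<ge>no. norm (d n (c n) - 0) < r" by (simp add: eventually_sequentially)
  qed
  with c(1) show ?thesis by blast
qed

section \<open>Codes built from codebooks\<close>

lemma messages_eq: "messages R n = {1..card (messages R n)}"
  unfolding card_messages by (auto simp: messages_def le_nat_iff le_floor_iff)

text \<open>Rounding a number that is at least 1 down to an integer loses at most a factor of
  2.\<close>

lemma card_messages_ge:
  assumes "0 \<le> R"
  shows "1 \<le> card (messages R n)" and "2 powr (real n * R) / 2 \<le> real (card (messages R n))"
proof -
  have ge: "1 \<le> 2 powr (real n * R)" using assms by (intro ge_one_powr_ge_zero) auto
  then have "1 \<le> \<lfloor>2 powr (real n * R)\<rfloor>" by simp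
  then show "1 \<le> card (messages R n)" "2 powr (real n * R) / 2 \<le> real (card (messages R n))"
    unfolding card_messages by linarith+
qed

text \<open>A fallback for the lengths at which no good code is guaranteed;
  \<open>diagonal_choice\<close> needs some code at every length.\<close>

lemma ex_coordination_code:
  assumes "0 \<le> R"
  shows "\<exists>enc dec zs. coordination_code R n enc dec zs"
proof -
  have "1 \<le> 2 powr (real n * R)" using assms by (intro ge_one_powr_ge_zero) auto
  then have "1 \<in> messages R n" by (simp add: messages_def)
  then show ?thesis
    by (intro exI[of _ "\<lambda>_. 1"] exI[of _ "\<lambda>_. replicate n undefined"] exI[of _ "replicate n undefined"])
       (simp add: coordination_code_def blocks_def)
qed

lemma code_of_codebook:
  fixes ys :: "'y::finite list list" and zs :: "'z::finite list" and p0 :: "'x::finite pmf"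
  assumes n: "n \<ge> 1" and R: "0 \<le> R" and zs: "zs \<in> blocks n"
    and ys: "length ys = card (messages R n)" "set ys \<subseteq> blocks n"
    and f: "\<And>t. 0 \<le> f t" "sum f UNIV = 1" and e: "0 \<le> \<epsilon>"
    and A: "\<And>xs y. A xs y \<Longrightarrow> tv_dist (joint_type n xs y zs) f \<le> \<epsilon>"
  shows "\<exists>enc dec. coordination_code R n enc dec zs \<and> mean_distortion p0 f n enc dec zs
    \<le> \<epsilon> + (\<Sum>xs\<in>blocks n. pmf (replicate_pmf n p0) xs * of_bool (\<forall>y\<in>set ys. \<not> A xs y))"
proof -
  define M where "M = card (messages R n)"
  \<comment> \<open>Messages start at 1 and list positions at 0.\<close>
  define dec where "dec m = ys ! (m - 1)" for m
  \<comment> \<open>Uncovered blocks are sent to message 1; their distortion is bounded by 1, which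
    is what the indicator in the conclusion pays for.\<close>
  define enc where "enc xs = (if \<exists>m\<in>{1..M}. A xs (dec m) then SOME m. m \<in> {1..M} \<and> A xs (dec m) else 1)" for xs
  have M: "1 \<le> M" "messages R n = {1..M}"
    unfolding M_def by (rule card_messages_ge(1)[OF R], rule messages_eq)
  have enc: "enc xs \<in> {1..M} \<and> A xs (dec (enc xs))" if "y \<in> set ys" "A xs y" for xs y
  proof -
    obtain j where "j < M" "y = ys ! j" using \<open>y \<in> set ys\<close> ys(1) by (auto simp: in_set_conv_nth M_def)
    then have ex: "\<exists>m. m \<in> {1..M} \<and> A xs (dec m)" using that(2) by (intro exI[of _ "Suc j"]) (simp add: dec_def)
    then have "enc xs = (SOME m. m \<in> {1..M} \<and> A xs (dec m))" unfolding enc_def by auto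
    with someI_ex[OF ex] show ?thesis by simp
  qed
  have enc_range: "enc xs \<in> {1..M}" for xs
  proof (cases "\<exists>m\<in>{1..M}. A xs (dec m)")
    case True
    then have "\<exists>m. m \<in> {1..M} \<and> A xs (dec m)" by blast
    from someI_ex[OF this] True show ?thesis unfolding enc_def by simp
  next
    case False
    with M show ?thesis unfolding enc_def by simp
  qed
  have "dec m \<in> blocks n" if "m \<in> {1..M}" for m
  proof -
    have "ys ! (m - 1) \<in> set ys" using that ys(1) by (intro nth_mem) (auto simp: M_def)
    then show ?thesis using ys(2) by (auto simp: dec_def)
  qed
  then have code: "coordination_code R n enc dec zs"
    using enc_range zs by (auto simp: coordination_code_def M)
  have "tv_dist (joint_type n xs (dec (enc xs)) zs) f \<le> \<epsilon> + of_bool (\<forall>y\<in>set ys. \<not> A xs y)" for xs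
  proof (cases "\<forall>y\<in>set ys. \<not> A xs y")
    case True
    have "tv_dist (joint_type n xs (dec (enc xs)) zs) f \<le> 1"
      using n f by (intro tv_dist_le_1 joint_type_nonneg sum_joint_type) auto
    with True e show ?thesis by simp
  next
    case False
    then have "A xs (dec (enc xs))" using enc by blast
    from A[OF this] False show ?thesis by simp
  qed
  then have "mean_distortion p0 f n enc dec zs
      \<le> (\<Sum>xs\<in>blocks n. pmf (replicate_pmf n p0) xs * (\<epsilon> + of_bool (\<forall>y\<in>set ys. \<not> A xs y)))"
    unfolding mean_distortion_def by (intro sum_mono mult_left_mono) auto
  also have "\<dots> = \<epsilon> + (\<Sum>xs\<in>blocks n. pmf (replicate_pmf n p0) xs * of_bool (\<forall>y\<in>set ys. \<not> A xs y))"
    by (simp add: distrib_left sum.distrib sum_pmf_blocks flip: sum_distrib_right)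
  finally show ?thesis using code by blast
qed

lemma sum_blocks_triple:
  fixes F :: "'x::finite list \<Rightarrow> 'y::finite list \<Rightarrow> 'z::finite list \<Rightarrow> 'b::comm_monoid_add"
  shows "(\<Sum>xs\<in>blocks n. \<Sum>ys\<in>blocks n. \<Sum>zs\<in>blocks n. F xs ys zs)
    = (\<Sum>ts\<in>blocks n. F (map fst ts) (map (fst \<circ> snd) ts) (map (snd \<circ> snd) ts))"
proof -
  have "bij_betw (\<lambda>ts :: ('x \<times> 'y \<times> 'z) list. (map fst ts, map (fst \<circ> snd) ts, map (snd \<circ> snd) ts))
    (blocks n) (blocks n \<times> blocks n \<times> blocks n)"
    by (rule bij_betw_byWitness[where f' = "\<lambda>(xs, ys, zs). zip xs (zip ys zs)"])
       (auto simp: blocks_def zip_map_map zip_map_fst_snd intro!: nth_equalityI)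
  from sum.reindex_bij_betw[OF this, of "\<lambda>(xs, ys, zs). F xs ys zs"] show ?thesis
    by (simp add: sum.cartesian_product)
qed

text \<open>\<open>\<iota>\<close> is the information density in nats. Its sum along a block of
  positive probability is the logarithm of the likelihood ratio needed for covering, so the
  threshold \<open>L\<close> on that sum yields the constant \<open>K = exp L\<close>.\<close>

lemma ex_code_mean_distortion_le:
  fixes p0 :: "'x::finite pmf" and pz :: "'z::finite pmf" and V :: "'x \<Rightarrow> 'z \<Rightarrow> 'y::finite pmf"
  defines "J \<equiv> joint_pmf p0 (factored_kernel pz V)"
  defines "f \<equiv> pmf J"
  defines "\<iota> \<equiv> \<lambda>(x, y, z). ln (f (x, y, z) / (pmf p0 x * mass_YZ f y z))"
  assumes n: "n \<ge> 1" and R: "0 \<le> R" and e: "0 \<le> \<epsilon>"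
  shows "\<exists>enc dec zs. coordination_code R n enc dec zs \<and> mean_distortion p0 f n enc dec zs
    \<le> \<epsilon> + measure_pmf.prob (replicate_pmf n J)
            {ts. \<epsilon> < tv_dist (\<lambda>t. (1 / real n) * (\<Sum>i<n. of_bool (ts ! i = t))) f \<or> L < (\<Sum>i<n. \<iota> (ts ! i))}
        + exp (- (real (card (messages R n)) / exp L))"
proof -
  \<comment> \<open>The conditional law of \<open>Y\<close> given \<open>Z\<close>; the average over
    \<open>x\<close> uses \<open>p0\<close> itself because \<open>X\<close> is independent of
    \<open>Z\<close>. Without a division by \<open>pmf pz z\<close> it is a distribution for every
    \<open>z\<close>.\<close>
  define U where "U z y = (\<Sum>x\<in>UNIV. pmf p0 x * pmf (V x z) y)" for z y
  define T where "T xs ys zs i = (xs ! i, ys ! i, zs ! i)" for xs :: "'x list" and ys :: "'y list" and zs :: "'z list" and i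
  \<comment> \<open>The last clause excludes letters at which \<open>\<iota>\<close> is the value of
    \<open>ln\<close> at 0 and bounds no ratio. It discards only blocks of probability 0 under
    \<open>J\<close>.\<close>
  define A where "A xs ys zs \<longleftrightarrow> tv_dist (joint_type n xs ys zs) f \<le> \<epsilon> \<and>
     (\<Sum>i<n. \<iota> (T xs ys zs i)) \<le> L \<and> (\<forall>i<n. f (T xs ys zs i) \<noteq> 0)" for xs ys zs
  define \<mu> where "\<mu> = pmf (replicate_pmf n p0)"
  define \<sigma> where "\<sigma> = pmf (replicate_pmf n pz)"
  define Vk where "Vk xs zs ys = (\<Prod>i<n. pmf (V (xs ! i) (zs ! i)) (ys ! i))" for xs zs ys
  define Uk where "Uk zs ys = (\<Prod>i<n. U (zs ! i) (ys ! i))" for zs ys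
  have f: "f (x, y, z) = pmf p0 x * pmf pz z * pmf (V x z) y" for x y z
    by (simp add: f_def J_def pmf_joint_factored)
  have mYZ: "mass_YZ f y z = pmf pz z * U z y" for y z
    by (simp add: mass_YZ_def f U_def sum_distrib_left mult_ac)
  have U0: "0 \<le> U z y" for z y by (simp add: U_def sum_nonneg)
  have U1: "(\<Sum>y\<in>UNIV. U z y) = 1" for z
    unfolding U_def by (subst sum.swap) (simp flip: sum_distrib_left)
  have ratio: "pmf (V x z) y \<le> exp (\<iota> (x, y, z)) * U z y" if "f (x, y, z) \<noteq> 0" for x y z
  proof -
    have pos: "0 < f (x, y, z)" using that by (simp add: f_def order_less_le)
    have "\<forall>t. 0 \<le> f t" by (simp add: f_def)
    then have "0 < mass_YZ f y z" using pos by (rule mass_YZ_pos)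
    then have "0 < pmf pz z" "0 < U z y" by (auto simp: mYZ zero_less_mult_iff order_less_le U0)
    moreover have "0 < pmf p0 x" "0 < pmf (V x z) y" using that by (auto simp: f order_less_le)
    ultimately show ?thesis by (simp add: \<iota>_def mYZ f)
  qed
  have VU: "Vk xs zs ys \<le> exp L * Uk zs ys" if "A xs ys zs" for xs ys zs
  proof -
    have "Vk xs zs ys \<le> (\<Prod>i<n. exp (\<iota> (T xs ys zs i)) * U (zs ! i) (ys ! i))"
      unfolding Vk_def by (intro prod_mono) (use that in \<open>auto simp: A_def T_def intro!: ratio\<close>)
    also have "\<dots> = exp (\<Sum>i<n. \<iota> (T xs ys zs i)) * Uk zs ys"
      by (simp add: prod.distrib exp_sum Uk_def)
    also have "\<dots> \<le> exp L * Uk zs ys"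
      using that by (intro mult_right_mono) (auto simp: A_def Uk_def intro!: prod_nonneg U0)
    finally show ?thesis .
  qed
  have Vk1: "(\<Sum>ys\<in>blocks n. Vk xs zs ys) = 1" for xs zs
    unfolding Vk_def sum_blocks_prod[of "\<lambda>i. pmf (V (xs ! i) (zs ! i))"] by simp
  have Uk1: "(\<Sum>ys\<in>blocks n. Uk zs ys) = 1" for zs
    unfolding Uk_def sum_blocks_prod[of "\<lambda>i. U (zs ! i)"] by (simp add: U1)
  have covering: "\<exists>zs\<in>blocks n. \<exists>ys. length ys = card (messages R n) \<and> set ys \<subseteq> blocks n \<and>
    (\<Sum>xs\<in>blocks n. \<mu> xs * of_bool (\<forall>y\<in>set ys. \<not> A xs y zs))
      \<le> 1 - (\<Sum>xs\<in>blocks n. \<Sum>ys\<in>blocks n. \<Sum>zs\<in>blocks n. \<mu> xs * \<sigma> zs * Vk xs zs ys * of_bool (A xs ys zs))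
        + exp (- (real (card (messages R n)) / exp L))"
  proof (rule one_shot_covering[where \<mu> = \<mu> and \<sigma> = \<sigma> and V = Vk and U = Uk])
    show "sum \<mu> (blocks n) = 1" "sum \<sigma> (blocks n) = 1" by (simp_all add: \<mu>_def \<sigma>_def sum_pmf_blocks)
    show "0 \<le> Vk xs zs ys" for xs ys zs by (simp add: Vk_def prod_nonneg)
    show "0 \<le> Uk zs ys" for ys zs by (simp add: Uk_def prod_nonneg U0)
  qed (simp_all add: \<mu>_def \<sigma>_def Vk1 Uk1 VU)
  obtain zs ys where zs: "zs \<in> blocks n" and ys: "length ys = card (messages R n)" "set ys \<subseteq> blocks n"
    and fail: "(\<Sum>xs\<in>blocks n. \<mu> xs * of_bool (\<forall>y\<in>set ys. \<not> A xs y zs))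
      \<le> 1 - (\<Sum>xs\<in>blocks n. \<Sum>ys\<in>blocks n. \<Sum>zs\<in>blocks n. \<mu> xs * \<sigma> zs * Vk xs zs ys * of_bool (A xs ys zs))
        + exp (- (real (card (messages R n)) / exp L))"
    using covering by blast
  define bad where "bad = {ts. \<epsilon> < tv_dist (\<lambda>t. (1 / real n) * (\<Sum>i<n. of_bool (ts ! i = t))) f \<or> L < (\<Sum>i<n. \<iota> (ts ! i))}"
  \<comment> \<open>The product weights make the zipped triple an i.i.d. block with law
    \<open>J\<close>, so the mass of \<open>A\<close> is the probability of not being
    atypical.\<close>
  have "(\<Sum>xs\<in>blocks n. \<Sum>ys\<in>blocks n. \<Sum>zs\<in>blocks n. \<mu> xs * \<sigma> zs * Vk xs zs ys * of_bool (A xs ys zs))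
      = (\<Sum>ts\<in>blocks n. pmf (replicate_pmf n J) ts * of_bool (ts \<notin> bad))"
    unfolding sum_blocks_triple
  proof (rule sum.cong[OF refl])
    fix ts :: "('x \<times> 'y \<times> 'z) list" assume ts: "ts \<in> blocks n"
    let ?xs = "map fst ts" and ?ys = "map (fst \<circ> snd) ts" and ?zs = "map (snd \<circ> snd) ts"
    have l: "length ts = n" using ts by (simp add: blocks_def)
    have nth: "T ?xs ?ys ?zs i = ts ! i" "(?xs ! i, ?ys ! i, ?zs ! i) = ts ! i" if "i < n" for i
      using that l by (simp_all add: T_def)
    have P: "pmf (replicate_pmf n J) ts = (\<Prod>i<n. f (ts ! i))"
      by (simp add: pmf_replicate_pmf[OF l] f_def)
    have "(\<Prod>i<n. f (ts ! i)) = (\<Prod>i<n. pmf p0 (?xs ! i) * pmf pz (?zs ! i) * pmf (V (?xs ! i) (?zs ! i)) (?ys ! i))"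
      by (intro prod.cong refl) (simp add: l f[symmetric])
    also have "\<dots> = \<mu> ?xs * \<sigma> ?zs * Vk ?xs ?zs ?ys"
      by (simp add: prod.distrib \<mu>_def \<sigma>_def Vk_def pmf_replicate_pmf l)
    finally have Q: "\<mu> ?xs * \<sigma> ?zs * Vk ?xs ?zs ?ys = pmf (replicate_pmf n J) ts" by (simp add: P)
    have jt: "joint_type n ?xs ?ys ?zs = (\<lambda>t. (1 / real n) * (\<Sum>i<n. of_bool (ts ! i = t)))"
      unfolding joint_type_def using nth(2) by (intro ext) simp
    have s: "(\<Sum>i<n. \<iota> (T ?xs ?ys ?zs i)) = (\<Sum>i<n. \<iota> (ts ! i))" using nth(1) by simp
    have "of_bool (A ?xs ?ys ?zs) = (of_bool (ts \<notin> bad) :: real)" if "pmf (replicate_pmf n J) ts \<noteq> 0"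
    proof -
      have "\<forall>i<n. f (T ?xs ?ys ?zs i) \<noteq> 0" using that nth(1) by (simp add: P)
      then show ?thesis unfolding A_def jt s bad_def by auto
    qed
    then show "\<mu> ?xs * \<sigma> ?zs * Vk ?xs ?zs ?ys * of_bool (A ?xs ?ys ?zs)
       = pmf (replicate_pmf n J) ts * of_bool (ts \<notin> bad)"
      unfolding Q by (cases "pmf (replicate_pmf n J) ts = 0") simp_all
  qed
  also have "\<dots> = measure_pmf.prob (replicate_pmf n J) (- bad)"
    by (simp add: prob_replicate_pmf)
  also have "\<dots> = 1 - measure_pmf.prob (replicate_pmf n J) bad"
    by (simp add: measure_pmf.prob_compl[of bad, simplified] Compl_eq_Diff_UNIV)
  finally have fail': "(\<Sum>xs\<in>blocks n. \<mu> xs * of_bool (\<forall>y\<in>set ys. \<not> A xs y zs))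
      \<le> measure_pmf.prob (replicate_pmf n J) bad + exp (- (real (card (messages R n)) / exp L))"
    using fail by simp
  obtain enc dec where "coordination_code R n enc dec zs"
    "mean_distortion p0 f n enc dec zs
      \<le> \<epsilon> + (\<Sum>xs\<in>blocks n. \<mu> xs * of_bool (\<forall>y\<in>set ys. \<not> A xs y zs))"
    using code_of_codebook[OF n R zs ys, of f \<epsilon> "\<lambda>xs y. A xs y zs" p0] e
    by (auto simp: f_def A_def \<mu>_def)
  with fail' show ?thesis unfolding bad_def by (intro exI[of _ enc] exI[of _ dec] exI[of _ zs]) simp
qed

text \<open>Finitely many weak laws: one for the frequency of each letter, with an equal share
  \<open>\<epsilon> / N\<close> of the tolerance, and one for \<open>g\<close>.\<close>

lemma tendsto_prob_atypical:
  fixes J :: "'a::finite pmf" and g :: "'a \<Rightarrow> real"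
  assumes e: "0 < \<epsilon>" and d: "0 < \<delta>" and m: "m = (\<Sum>t\<in>UNIV. pmf J t * g t)"
  shows "(\<lambda>n. measure_pmf.prob (replicate_pmf n J)
     {ts. \<epsilon> < tv_dist (\<lambda>t. (1 / real n) * (\<Sum>i<n. of_bool (ts ! i = t))) (pmf J)
        \<or> real n * (m + \<delta>) < (\<Sum>i<n. g (ts ! i))}) \<longlonglongrightarrow> 0"
proof -
  define N where "N = real (card (UNIV :: 'a set))"
  have N: "N > 0" by (simp add: N_def card_gt_0_iff)
  define S where "S t n = {ts :: 'a list. real n * (\<epsilon> / N) < \<bar>(\<Sum>i<n. of_bool (ts ! i = t)) - real n * pmf J t\<bar>}" for t n
  define G where "G n = {ts. real n * \<delta> < \<bar>(\<Sum>i<n. g (ts ! i)) - real n * m\<bar>}" for n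
  let ?B = "\<lambda>n. {ts. \<epsilon> < tv_dist (\<lambda>t. (1 / real n) * (\<Sum>i<n. of_bool (ts ! i = t))) (pmf J)
        \<or> real n * (m + \<delta>) < (\<Sum>i<n. g (ts ! i))}"
  have sub: "?B n \<subseteq> (\<Union>t. S t n) \<union> G n" if n: "n \<ge> 1" for n
  proof
    fix ts assume ts: "ts \<in> ?B n"
    show "ts \<in> (\<Union>t. S t n) \<union> G n"
    proof (rule ccontr)
      assume not: "ts \<notin> (\<Union>t. S t n) \<union> G n"
      have "\<bar>(1 / real n) * (\<Sum>i<n. of_bool (ts ! i = t)) - pmf J t\<bar> \<le> \<epsilon> / N" for t
      proof -
        have "\<bar>(\<Sum>i<n. of_bool (ts ! i = t)) - real n * pmf J t\<bar> \<le> real n * (\<epsilon> / N)"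
          using not by (auto simp: S_def not_less)
        moreover have "(\<Sum>i<n. of_bool (ts ! i = t)) - real n * pmf J t
            = real n * ((1 / real n) * (\<Sum>i<n. of_bool (ts ! i = t)) - pmf J t)"
          using n by (simp add: right_diff_distrib)
        ultimately have "real n * \<bar>(1 / real n) * (\<Sum>i<n. of_bool (ts ! i = t)) - pmf J t\<bar> \<le> real n * (\<epsilon> / N)"
          by (simp add: abs_mult)
        then show ?thesis by (rule mult_left_le_imp_le) (use n in simp)
      qed
      then have "(\<Sum>t\<in>UNIV. \<bar>(1 / real n) * (\<Sum>i<n. of_bool (ts ! i = t)) - pmf J t\<bar>) \<le> (\<Sum>t\<in>(UNIV :: 'a set). \<epsilon> / N)"
        by (rule sum_mono)
      also have "\<dots> = \<epsilon>" using N by (simp add: N_def)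
      finally have "tv_dist (\<lambda>t. (1 / real n) * (\<Sum>i<n. of_bool (ts ! i = t))) (pmf J) \<le> \<epsilon>"
        using e by (simp add: tv_dist_def)
      moreover have "(\<Sum>i<n. g (ts ! i)) \<le> real n * (m + \<delta>)"
        using not by (auto simp: G_def distrib_left)
      ultimately show False using ts by auto
    qed
  qed
  have le: "measure_pmf.prob (replicate_pmf n J) (?B n)
     \<le> (\<Sum>t\<in>UNIV. measure_pmf.prob (replicate_pmf n J) (S t n)) + measure_pmf.prob (replicate_pmf n J) (G n)"
    if n: "n \<ge> 1" for n
  proof -
    have "measure_pmf.prob (replicate_pmf n J) (?B n) \<le> measure_pmf.prob (replicate_pmf n J) ((\<Union>t. S t n) \<union> G n)"
      by (rule measure_pmf.finite_measure_mono[OF sub[OF n]]) simp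
    also have "\<dots> \<le> measure_pmf.prob (replicate_pmf n J) (\<Union>t. S t n) + measure_pmf.prob (replicate_pmf n J) (G n)"
      by (rule measure_Un_le) simp_all
    also have "measure_pmf.prob (replicate_pmf n J) (\<Union>t. S t n)
        \<le> (\<Sum>t\<in>UNIV. measure_pmf.prob (replicate_pmf n J) (S t n))"
      by (rule measure_pmf.finite_measure_subadditive_finite) simp_all
    finally show ?thesis by simp
  qed
  have "(\<lambda>n. measure_pmf.prob (replicate_pmf n J) (S t n)) \<longlonglongrightarrow> 0" for t
    unfolding S_def using e N by (intro weak_law_replicate_pmf) (simp_all add: sum_mult_of_bool_point)
  moreover have "(\<lambda>n. measure_pmf.prob (replicate_pmf n J) (G n)) \<longlonglongrightarrow> 0"
    unfolding G_def by (rule weak_law_replicate_pmf[OF d m])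
  ultimately have lim: "(\<lambda>n. (\<Sum>t\<in>UNIV. measure_pmf.prob (replicate_pmf n J) (S t n))
      + measure_pmf.prob (replicate_pmf n J) (G n)) \<longlonglongrightarrow> 0"
    by (auto intro!: tendsto_eq_intros)
  show ?thesis
    by (rule tendsto_sandwich[OF _ eventually_mono[OF eventually_ge_at_top[of 1] le] tendsto_const lim]) simp_all
qed

lemma achievable_of_info_less:
  fixes p0 :: "'x::finite pmf" and pz :: "'z::finite pmf" and V :: "'x \<Rightarrow> 'z \<Rightarrow> 'y::finite pmf"
  assumes less: "info (pmf p0) (pmf (joint_pmf p0 (factored_kernel pz V))) < R * ln 2"
  shows "achievable p0 R (factored_kernel pz V)"
proof -
  define J where "J = joint_pmf p0 (factored_kernel pz V)"
  define I where "I = info (pmf p0) (pmf J)"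
  define \<iota> where "\<iota> = (\<lambda>(x, y, z). ln (pmf J (x, y, z) / (pmf p0 x * mass_YZ (pmf J) y z)))"
  \<comment> \<open>Half the gap: \<open>R * ln 2 = I + 2 * \<delta>\<close>. The threshold lies
    \<open>\<delta>\<close> above the mean of \<open>\<iota>\<close>, and up to rounding the
    codebook still exceeds \<open>exp (n * (I + \<delta>))\<close> by the factor
    \<open>exp (n * \<delta>)\<close>.\<close>
  define \<delta> where "\<delta> = (R * ln 2 - I) / 2"
  have \<delta>: "\<delta> > 0" using less by (simp add: \<delta>_def I_def J_def)
  have "0 \<le> I" unfolding I_def J_def by (rule info_nonneg[OF indep_joint_factored]) simp
  then have "0 < R * ln 2" using less by (simp add: I_def J_def)
  \<comment> \<open>\<open>achievable\<close> demands a nonnegative rate; it comes from the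
    nonnegativity of the information.\<close>
  then have R: "0 \<le> R" by (simp add: zero_less_mult_iff)
  have I: "I = (\<Sum>t\<in>UNIV. pmf J t * \<iota> t)" by (simp add: I_def info_def \<iota>_def case_prod_unfold)
  define E where "E n = exp (- (real (card (messages R n)) / exp (real n * (I + \<delta>))))" for n
  have E: "E \<longlonglongrightarrow> 0"
  proof -
    have "E n \<le> exp (- (exp (real n * \<delta>) / 2))" for n
    proof -
      have "exp (real n * \<delta>) = 2 powr (real n * R) / exp (real n * (I + \<delta>))"
        by (simp add: powr_def \<delta>_def field_simps flip: exp_diff)
      then have "exp (real n * \<delta>) / 2 = (2 powr (real n * R) / 2) / exp (real n * (I + \<delta>))" by simp
      also have "\<dots> \<le> real (card (messages R n)) / exp (real n * (I + \<delta>))"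
        by (intro divide_right_mono card_messages_ge(2)[OF R]) simp
      finally show ?thesis by (simp add: E_def)
    qed
    then have le: "\<forall>n. E n \<le> exp (- (exp (real n * \<delta>) / 2))" ..
    have lim: "(\<lambda>n. exp (- (exp (real n * \<delta>) / 2))) \<longlonglongrightarrow> 0" using \<delta> by real_asymp
    show ?thesis
      by (rule tendsto_sandwich[OF always_eventually always_eventually[OF le] tendsto_const lim]) (simp add: E_def)
  qed
  have "\<exists>c. (\<forall>n. (case c n of (enc, dec, zs) \<Rightarrow> coordination_code R n enc dec zs)) \<and>
      (\<lambda>n. case c n of (enc, dec, zs) \<Rightarrow> mean_distortion p0 (pmf J) n enc dec zs) \<longlonglongrightarrow> 0"
  proof (rule diagonal_choice)
    show "\<exists>c. case c of (enc, dec, zs) \<Rightarrow> coordination_code R n enc dec zs" for n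
      using ex_coordination_code[OF R, of n] by auto
    show "0 \<le> (case c of (enc, dec, zs) \<Rightarrow> mean_distortion p0 (pmf J) n enc dec zs)" for n c
      by (simp add: mean_distortion_nonneg split: prod.split)
    fix e :: real assume e: "e > 0"
    \<comment> \<open>Three error terms, the typicality radius, atypical blocks and a codebook that
      is too small, receive \<open>e / 3\<close> each.\<close>
    let ?B = "\<lambda>n. measure_pmf.prob (replicate_pmf n J)
     {ts. e / 3 < tv_dist (\<lambda>t. (1 / real n) * (\<Sum>i<n. of_bool (ts ! i = t))) (pmf J)
        \<or> real n * (I + \<delta>) < (\<Sum>i<n. \<iota> (ts ! i))}"
    have "?B \<longlonglongrightarrow> 0" by (rule tendsto_prob_atypical[OF _ \<delta> I]) (use e in simp)
    then have "eventually (\<lambda>n. ?B n < e / 3) sequentially" using e by (intro order_tendstoD(2)[of _ 0]) simp_all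
    moreover have "eventually (\<lambda>n. E n < e / 3) sequentially" using E e by (intro order_tendstoD(2)[of _ 0]) simp_all
    ultimately show "eventually (\<lambda>n. \<exists>c. (case c of (enc, dec, zs) \<Rightarrow> coordination_code R n enc dec zs) \<and>
        (case c of (enc, dec, zs) \<Rightarrow> mean_distortion p0 (pmf J) n enc dec zs) \<le> e) sequentially"
      using eventually_ge_at_top[of 1]
    proof eventually_elim
      case (elim n)
      have "0 \<le> e / 3" using e by simp
      from ex_code_mean_distortion_le[OF elim(3) R this, of p0 pz V "real n * (I + \<delta>)",
          folded J_def, folded \<iota>_def, folded E_def]
      obtain enc dec zs where "coordination_code R n enc dec zs"
        "mean_distortion p0 (pmf J) n enc dec zs \<le> e / 3 + ?B n + E n"
        by blast
      with elim show ?case by (intro exI[of _ "(enc, dec, zs)"]) simp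
    qed
  qed
  then obtain c where c: "\<And>n. case c n of (enc, dec, zs) \<Rightarrow> coordination_code R n enc dec zs"
    "(\<lambda>n. case c n of (enc, dec, zs) \<Rightarrow> mean_distortion p0 (pmf J) n enc dec zs) \<longlonglongrightarrow> 0"
    by blast
  show ?thesis
    unfolding achievable_iff J_def[symmetric] using R c
    by (intro conjI exI[of _ "\<lambda>n. fst (c n)"] exI[of _ "\<lambda>n. fst (snd (c n))"] exI[of _ "\<lambda>n. snd (snd (c n))"])
       (auto simp: case_prod_unfold)
qed

section \<open>Equality of the operational and the single-letter region\<close>

lemma coordination_capacity_region_eq: "coordination_capacity_region p0 = rate_region p0"
proof
  show "coordination_capacity_region p0 \<subseteq> rate_region p0"
    unfolding coordination_capacity_region_def
    by (rule closure_minimal[OF _ closed_rate_region]) (auto intro: achievable_imp_rate_region)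
  show "rate_region p0 \<subseteq> coordination_capacity_region p0"
  proof
    fix w assume w: "w \<in> rate_region p0"
    obtain R f where Rf: "w = (R, f)" by (cases w)
    with w have f: "indep_joint (pmf p0) f" and le: "info (pmf p0) f \<le> R * ln 2"
      by (simp_all add: rate_region_def)
    from indep_joint_imp_factored[OF f] obtain pz V
      where fV: "pmf (joint_pmf p0 (factored_kernel pz V)) = f" by blast
    \<comment> \<open>The slack needed for random coding is bought with a little extra rate, which
      disappears in the limit taken by the closure.\<close>
    have "(R + inverse (real (Suc n)), f) \<in> {(R, pmf (joint_pmf p0 W)) | R W. achievable p0 R W}" for n
    proof -
      have "info (pmf p0) f < (R + inverse (real (Suc n))) * ln 2"
        using le by (intro le_less_trans[OF le]) simp
      then have "achievable p0 (R + inverse (real (Suc n))) (factored_kernel pz V)"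
        by (intro achievable_of_info_less) (simp only: fV)
      then show ?thesis using fV by blast
    qed
    moreover have "(\<lambda>n. (R + inverse (real (Suc n)), f)) \<longlonglongrightarrow> (R + 0, f)"
      by (intro tendsto_Pair tendsto_add tendsto_const LIMSEQ_inverse_real_of_nat)
    ultimately show "w \<in> coordination_capacity_region p0"
      unfolding coordination_capacity_region_def closure_sequential Rf add_0_right
      by (intro exI[of _ "\<lambda>n. (R + inverse (real (Suc n)), f)"]) blast
  qed
qed

theorem theorem4:
  fixes p0 :: "'x::finite pmf"
  shows "(coordination_capacity_region p0 :: (real \<times> ('x \<times> 'y::finite \<times> 'z::finite \<Rightarrow> real)) set) =
           {(R, pmf (joint_pmf p0 W)) | R W.
              Z_indep_X (joint_pmf p0 W) \<and> R \<ge> cond_mutual_info (joint_pmf p0 W)} \<and>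
         (coordination_capacity_region p0 :: (real \<times> ('x \<times> 'y \<times> 'z \<Rightarrow> real)) set) =
           {(R, pmf (joint_pmf p0 (factored_kernel pz V))) | R pz V.
              R \<ge> cond_mutual_info (joint_pmf p0 (factored_kernel pz V))}"
  unfolding coordination_capacity_region_eq by (intro conjI rate_region_eq)

end
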